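(* (1) For each $\lambda\in\mathbb N$, the set $\{t_{\mathrm{odd}}^{(n)} v^+_{2\lambda+1}\mid 0\le n\le 2\lambda+1\}$ forms the $\imath$-canonical basis for $L(2\lambda+1)$. Moreover, $t_{\mathrm{odd}}^{(2\lambda+2)}v^+_{2\lambda+1}=t_{\mathrm{odd}}^{(2\lambda+1)}v^+_{2\lambda+1}$, and $t_{\mathrm{odd}}^{(n)} v^+_{2\lambda+1}=0$ for $n\ge 2\lambda+3$. (2) The set $\{t_{\mathrm{odd}}^{(n)}\mid n\in\mathbb N\}$ forms the $\imath$-canonical basis for $\mathbf U^\imath$ (of odd parity, i.e. relative to the modules $L(2\lambda+1)$, $\lambda\in\mathbb N$).
   Context: $\mathbb N=\{0,1,2,\dots\}$. $\mathbf U=\mathbf U_q(\mathfrak{sl}_2)$ is the $\mathbb Q(q)$-algebra generated by $E,F,K,K^{-1}$ with relations $KK^{-1}=K^{-1}K=1$, $EF-FE=\frac{K-K^{-1}}{q-q^{-1}}$, $KE=q^2EK$, $KF=q^{-2}FK$. For $n\in\mathbb Z$, $[n]=\frac{q^n-q^{-n}}{q-q^{-1}}$, and $[n]!=[1]\cdots[n]$ for $n\ge 0$; $F^{(n)}=F^n/[n]!$. Put $\check E=q^{-1}EK^{-1}$ and $t=\check E+F+K^{-1}$. Here $\mathbf U^\imath$ is the $\mathbb Q(q)$-subalgebra of $\mathbf U$ generated by $t$ (a polynomial algebra in $t$). The $\imath$-divided powers $t_{\mathrm{odd}}^{(n)}$ are the polynomials in $t$ determined by $t_{\mathrm{odd}}^{(0)}=1$,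 $t_{\mathrm{odd}}^{(1)}=t$, and, for $a\ge 1$: $t\cdot t_{\mathrm{odd}}^{(2a-1)}=[2a]\,t_{\mathrm{odd}}^{(2a)}$, $t\cdot t_{\mathrm{odd}}^{(2a)}=[2a+1]\,t_{\mathrm{odd}}^{(2a+1)}+[2a]\,t_{\mathrm{odd}}^{(2a-1)}$. Equivalently, $t_{\mathrm{odd}}^{(2a)}=\frac{1}{[2a]!}\,t\prod_{i=1-a}^{a-1}(t-[2i])$ for $a\ge1$ and $t_{\mathrm{odd}}^{(2a+1)}=\frac{1}{[2a+1]!}\prod_{i=-a}^{a}(t-[2i])$ for $a\ge 0$. For $\mu\in\mathbb N$, $L(\mu)$ is the simple $\mathbf U$-module of highest weight $\mu$ (dimension $\mu+1$) with highest weight vector $v^+_\mu$ (so $Ev^+_\mu=0$, $Kv^+_\mu=q^\mu v^+_\mu$); it has canonical basis $\{F^{(a)}v^+_\mu\mid 0\le a\le\mu\}$. For $\mu=2\lambda+1$, the bar involution $\psi_\imath$ on $L(\mu)$ is the $\mathbb Q$-linear map with $\psi_\imath(qx)=q^{-1}\psi_\imath(x)$ that fixes $t_{\mathrm{odd}}^{(n)}v^+_\mu$ for all $n\ge 0$ (equivalently, fixes $t^n v^+_\mu$ for all $n\ge 0$). The $\imath$-canonical basis $\{b^\mu_a\}_{0\le a\le\mu}$ of $L(\mu)$ is the basis characterized by: (i) $\psi_\imath(b^\mu_a)=b^\mu_a$; (ii) $b^\mu_a\in F^{(a)}v^+_\mu+\sum_{0\le r\le\mu}q^{-1}\mathbb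 Z[q^{-1}]F^{(r)}v^+_\mu$. The $\imath$-canonical basis for $\mathbf U^\imath$ of odd parity is the set $\{u_a\mid a\in\mathbb N\}$ where $u_a\in\mathbf U^\imath$ is the unique element with $u_a v^+_{2\lambda+1}=b^{2\lambda+1}_a$ for all sufficiently large $\lambda\in\mathbb N$. *)

theory Defs
  imports "HOL-Computational_Algebra.Computational_Algebra" "HOL-Library.FuncSet"
begin

type_synonym ratfun = "rat poly fract"

definition rat_const :: "rat \<Rightarrow> ratfun" where
  "rat_const c = Fract [:c:] 1"

definition q :: ratfun where
  "q = Fract [:0, 1:] 1"

definition qint :: "int \<Rightarrow> ratfun" where
  "qint n = (q powi n - q powi (- n)) / (q - inverse q)"

definition qfact :: "nat \<Rightarrow> ratfun" where
  "qfact n = (\<Prod>i=1..n. qint (int i))"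

text \<open>\<open>q\<^sup>-\<^sup>1 \<int>[q\<^sup>-\<^sup>1]\<close>\<close>
definition qinv_int_polys :: "ratfun set" where
  "qinv_int_polys = {inverse q * poly (map_poly of_int p) (inverse q) | p :: int poly. True}"

text \<open>The algebra is presented as formal expressions over the ground field in the four
  generators, modulo the least congruence that contains the axioms of associative unital algebras
  and the defining relations. Subtraction is expressed through the scalar \<open>-1\<close>.\<close>

datatype uexp =
    Scal ratfun | GenE | GenF | GenK | GenKinv
  | Add uexp uexp | Mul uexp uexp

inductive urel :: "uexp \<Rightarrow> uexp \<Rightarrow> bool" where
  urel_refl: "urel x x"
| urel_sym: "urel x y \<Longrightarrow> urel y x"
| urel_trans: "urel x y \<Longrightarrow> urel y z \<Longrightarrow> urel x z"
| urel_add_cong: "urel x x' \<Longrightarrow> urel y y' \<Longrightarrow> urel (Add x y) (Add x' y')"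
| urel_mul_cong: "urel x x' \<Longrightarrow> urel y y' \<Longrightarrow> urel (Mul x y) (Mul x' y')"
| urel_add_assoc: "urel (Add (Add x y) z) (Add x (Add y z))"
| urel_add_comm: "urel (Add x y) (Add y x)"
| urel_add_zero: "urel (Add (Scal 0) x) x"
| urel_add_neg: "urel (Add (Mul (Scal (- 1)) x) x) (Scal 0)"
| urel_mul_assoc: "urel (Mul (Mul x y) z) (Mul x (Mul y z))"
| urel_one_mul: "urel (Mul (Scal 1) x) x"
| urel_mul_one: "urel (Mul x (Scal 1)) x"
| urel_distrib_right: "urel (Mul (Add x y) z) (Add (Mul x z) (Mul y z))"
| urel_distrib_left: "urel (Mul x (Add y z)) (Add (Mul x y) (Mul x z))"
| urel_scal_add: "urel (Scal (c + d)) (Add (Scal c) (Scal d))"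
| urel_scal_mul: "urel (Scal (c * d)) (Mul (Scal c) (Scal d))"
| urel_scal_central: "urel (Mul (Scal c) x) (Mul x (Scal c))"
| urel_K_Kinv: "urel (Mul GenK GenKinv) (Scal 1)"
| urel_Kinv_K: "urel (Mul GenKinv GenK) (Scal 1)"
| urel_E_F: "urel (Add (Mul GenE GenF) (Mul (Scal (- 1)) (Mul GenF GenE)))
          (Mul (Scal (1 / (q - inverse q))) (Add GenK (Mul (Scal (- 1)) GenKinv)))"
| urel_K_E: "urel (Mul GenK GenE) (Mul (Scal (q\<^sup>2)) (Mul GenE GenK))"
| urel_K_F: "urel (Mul GenK GenF) (Mul (Scal (inverse (q\<^sup>2))) (Mul GenF GenK))"

quotient_type Uq = uexp / urel
proof (rule equivpI)
  show "reflp urel" by (rule reflpI) (rule urel_refl)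
  show "symp urel" by (rule sympI) (rule urel_sym)
  show "transp urel" by (rule transpI) (rule urel_trans)
qed

lift_definition UScal :: "ratfun \<Rightarrow> Uq" is Scal .
lift_definition UE :: Uq is GenE .
lift_definition UF :: Uq is GenF .
lift_definition UK :: Uq is GenK .
lift_definition UKinv :: Uq is GenKinv .

instantiation Uq :: ring
begin

lift_definition zero_Uq :: Uq is "Scal 0" .
lift_definition plus_Uq :: "Uq \<Rightarrow> Uq \<Rightarrow> Uq" is Add by (rule urel_add_cong)
lift_definition times_Uq :: "Uq \<Rightarrow> Uq \<Rightarrow> Uq" is Mul by (rule urel_mul_cong)
lift_definition uminus_Uq :: "Uq \<Rightarrow> Uq" is "Mul (Scal (- 1))"
  by (rule urel_mul_cong[OF urel_refl])
definition minus_Uq :: "Uq \<Rightarrow> Uq \<Rightarrow> Uq" where "minus_Uq x y = x + - y"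

instance
proof
  fix x y z :: Uq
  show "x + y + z = x + (y + z)" by transfer (rule urel_add_assoc)
  show "x + y = y + x" by transfer (rule urel_add_comm)
  show "0 + x = x" by transfer (rule urel_add_zero)
  show "- x + x = 0" by transfer (rule urel_add_neg)
  show "x - y = x + - y" by (rule minus_Uq_def)
  show "x * y * z = x * (y * z)" by transfer (rule urel_mul_assoc)
  show "(x + y) * z = x * z + y * z" by transfer (rule urel_distrib_right)
  show "x * (y + z) = x * y + x * z" by transfer (rule urel_distrib_left)
qed

end

instantiation Uq :: monoid_mult
begin

lift_definition one_Uq :: Uq is "Scal 1" .

instance
proof
  fix x :: Uq
  show "1 * x = x" by transfer (rule urel_one_mul)
  show "x * 1 = x" by transfer (rule urel_mul_one)
qed

end

lemma UScal_0: "UScal 0 = 0" by transfer (rule urel_refl)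
lemma UScal_1: "UScal 1 = 1" by transfer (rule urel_refl)
lemma UScal_add: "UScal (c + d) = UScal c + UScal d" by transfer (rule urel_scal_add)
lemma UScal_mult: "UScal (c * d) = UScal c * UScal d" by transfer (rule urel_scal_mul)
lemma UScal_central: "UScal c * x = x * UScal c" by transfer (rule urel_scal_central)

lemma UK_UKinv: "UK * UKinv = 1" by transfer (rule urel_K_Kinv)
lemma UKinv_UK: "UKinv * UK = 1" by transfer (rule urel_Kinv_K)

lemma UE_UF: "UE * UF - UF * UE = UScal (1 / (q - inverse q)) * (UK - UKinv)"
  unfolding minus_Uq_def by transfer (rule urel_E_F)

lemma UK_UE: "UK * UE = UScal (q\<^sup>2) * (UE * UK)" by transfer (rule urel_K_E)
lemma UK_UF: "UK * UF = UScal (inverse (q\<^sup>2)) * (UF * UK)" by transfer (rule urel_K_F)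

definition scaleU :: "ratfun \<Rightarrow> Uq \<Rightarrow> Uq" where
  "scaleU c x = UScal c * x"

global_interpretation Uq: vector_space scaleU
  by unfold_locales
    (simp_all add: scaleU_def distrib_left distrib_right UScal_add UScal_mult UScal_1 mult.assoc)

definition Fdiv :: "nat \<Rightarrow> Uq" where
  "Fdiv n = scaleU (inverse (qfact n)) (UF ^ n)"

definition Echeck :: Uq where
  "Echeck = scaleU (inverse q) (UE * UKinv)"

definition t :: Uq where
  "t = Echeck + UF + UKinv"

inductive_set generated_subalgebra :: "Uq set \<Rightarrow> Uq set" for S where
  subalg_gen: "x \<in> S \<Longrightarrow> x \<in> generated_subalgebra S"
| subalg_scal: "UScal c \<in> generated_subalgebra S"
| subalg_add: "x \<in> generated_subalgebra S \<Longrightarrow> y \<in> generated_subalgebra S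
    \<Longrightarrow> x + y \<in> generated_subalgebra S"
| subalg_mult: "x \<in> generated_subalgebra S \<Longrightarrow> y \<in> generated_subalgebra S
    \<Longrightarrow> x * y \<in> generated_subalgebra S"

definition Uiota :: "Uq set" where
  "Uiota = generated_subalgebra {t}"

text \<open>The two cases of the last equation are the recurrences \<open>t_odd_even\<close> and \<open>t_odd_odd\<close> below,
  solved for the divided power of highest index.\<close>
fun t_odd :: "nat \<Rightarrow> Uq" where
  "t_odd 0 = 1"
| "t_odd (Suc 0) = t"
| "t_odd (Suc (Suc n)) = scaleU (inverse (qint (int n + 2)))
     (if even n then t * t_odd (Suc n)
      else t * t_odd (Suc n) - scaleU (qint (int n + 1)) (t_odd n))"

lemma q_power: "q ^ n = Fract (monom 1 n) 1"
  by (induction n) (auto simp: q_def One_fract_def monom_Suc)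

lemma q_power_eq_iff: "q ^ m = q ^ n \<longleftrightarrow> m = n"
  by (auto simp: q_power eq_fract monom_eq_iff')

lemma q_nonzero: "q \<noteq> 0"
  by (simp add: q_def Zero_fract_def eq_fract)

lemma q_power_neq_inverse:
  assumes "n > 0" shows "q ^ n \<noteq> inverse (q ^ n)"
proof
  assume "q ^ n = inverse (q ^ n)"
  then have "q ^ n * q ^ n = 1" using q_nonzero by (metis power_eq_0_iff right_inverse)
  then have "q ^ (n + n) = q ^ 0" by (simp add: power_add)
  then show False using assms unfolding q_power_eq_iff by simp
qed

lemma qint_nonzero:
  assumes "n > 0" shows "qint (int n) \<noteq> 0"
  using q_power_neq_inverse[OF assms] q_power_neq_inverse[of 1]
  by (simp add: qint_def power_int_minus)

lemma t_odd_even: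
  assumes "a \<ge> 1"
  shows "t * t_odd (2 * a - 1) = scaleU (qint (2 * int a)) (t_odd (2 * a))"
proof -
  obtain b where b: "a = Suc b" using assms by (cases a) auto
  have "qint (2 * int a) \<noteq> 0" using qint_nonzero[of "2 * a"] b by simp
  then show ?thesis using b by (simp add: add.commute)
qed

lemma t_odd_odd:
  assumes "a \<ge> 1"
  shows "t * t_odd (2 * a) =
    scaleU (qint (2 * int a + 1)) (t_odd (2 * a + 1)) +
    scaleU (qint (2 * int a)) (t_odd (2 * a - 1))"
proof -
  obtain b where b: "a = Suc b" using assms by (cases a) auto
  define n where "n = 2 * b + 1"
  have n: "2 * a = Suc n" "2 * a + 1 = Suc (Suc n)" "2 * a - 1 = n" "odd n"
    "int n + 2 = 2 * int a + 1" "int n + 1 = 2 * int a"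
    by (simp_all add: n_def b)
  have "qint (2 * int a + 1) \<noteq> 0" using qint_nonzero[of "2 * a + 1"] by (simp add: add.commute)
  then show ?thesis unfolding n(1-3) using n(4) by (simp add: n(5,6))
qed

text \<open>Modules are carried by subsets of an ambient abelian group, so that modules of different
  dimensions can occur in one statement.\<close>

locale Uq_module =
  fixes V :: "'v::ab_group_add set" and act :: "Uq \<Rightarrow> 'v \<Rightarrow> 'v"
  assumes zero_closed: "0 \<in> V"
    and add_closed: "x \<in> V \<Longrightarrow> y \<in> V \<Longrightarrow> x + y \<in> V"
    and act_closed: "x \<in> V \<Longrightarrow> act u x \<in> V"
    and act_add_right: "x \<in> V \<Longrightarrow> y \<in> V \<Longrightarrow> act u (x + y) = act u x + act u y"
    and act_add_left: "x \<in> V \<Longrightarrow> act (u + w) x = act u x + act w x"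
    and act_mult: "x \<in> V \<Longrightarrow> act (u * w) x = act u (act w x)"
    and act_one: "x \<in> V \<Longrightarrow> act 1 x = x"

text \<open>These axioms characterize \<open>L(\<mu>)\<close> with its highest weight vector up to isomorphism;
  in particular they force dimension \<open>\<mu> + 1\<close>.\<close>
locale simple_highest_weight_module = Uq_module V act
  for \<mu> :: nat and V :: "'v::ab_group_add set" and act :: "Uq \<Rightarrow> 'v \<Rightarrow> 'v" and v :: 'v +
  assumes simple: "W \<subseteq> V \<Longrightarrow> Uq_module W act \<Longrightarrow> W = {0} \<or> W = V"
    and hwv_closed: "v \<in> V"
    and hwv_nonzero: "v \<noteq> 0"
    and E_hwv: "act UE v = 0"
    and K_hwv: "act UK v = act (UScal (q ^ \<mu>)) v"

text \<open>The linear structure of a module over the ground field is the action of the scalars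
  \<open>UScal c\<close>; a finite family is a basis if expansions exist and are unique.\<close>
definition is_basis :: "nat \<Rightarrow> 'v::ab_group_add set \<Rightarrow> (Uq \<Rightarrow> 'v \<Rightarrow> 'v) \<Rightarrow> (nat \<Rightarrow> 'v) \<Rightarrow> bool" where
  "is_basis \<mu> V act b \<longleftrightarrow> (\<forall>a\<le>\<mu>. b a \<in> V) \<and>
     (\<forall>x\<in>V. \<exists>!c. c \<in> {..\<mu>} \<rightarrow>\<^sub>E UNIV \<and> x = (\<Sum>a\<le>\<mu>. act (UScal (c a)) (b a)))"

definition is_bar_involution ::
    "'v::ab_group_add set \<Rightarrow> (Uq \<Rightarrow> 'v \<Rightarrow> 'v) \<Rightarrow> 'v \<Rightarrow> ('v \<Rightarrow> 'v) \<Rightarrow> bool" where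
  "is_bar_involution V act v \<psi> \<longleftrightarrow> \<psi> \<in> V \<rightarrow>\<^sub>E V \<and>
     (\<forall>x\<in>V. \<forall>y\<in>V. \<psi> (x + y) = \<psi> x + \<psi> y) \<and>
     (\<forall>c. \<forall>x\<in>V. \<psi> (act (UScal (rat_const c)) x) = act (UScal (rat_const c)) (\<psi> x)) \<and>
     (\<forall>x\<in>V. \<psi> (act (UScal q) x) = act (UScal (inverse q)) (\<psi> x)) \<and>
     (\<forall>n. \<psi> (act (t_odd n) v) = act (t_odd n) v)"

definition bar_involution ::
    "'v::ab_group_add set \<Rightarrow> (Uq \<Rightarrow> 'v \<Rightarrow> 'v) \<Rightarrow> 'v \<Rightarrow> 'v \<Rightarrow> 'v" where
  "bar_involution V act v = (THE \<psi>. is_bar_involution V act v \<psi>)"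

definition is_icanonical_basis ::
    "nat \<Rightarrow> 'v::ab_group_add set \<Rightarrow> (Uq \<Rightarrow> 'v \<Rightarrow> 'v) \<Rightarrow> 'v \<Rightarrow> (nat \<Rightarrow> 'v) \<Rightarrow> bool" where
  "is_icanonical_basis \<mu> V act v b \<longleftrightarrow> b \<in> {..\<mu>} \<rightarrow>\<^sub>E V \<and> is_basis \<mu> V act b \<and>
     (\<forall>a\<le>\<mu>. bar_involution V act v (b a) = b a) \<and>
     (\<forall>a\<le>\<mu>. \<exists>c. (\<forall>r\<le>\<mu>. c r \<in> qinv_int_polys) \<and>
        b a = act (Fdiv a) v + (\<Sum>r\<le>\<mu>. act (scaleU (c r) (Fdiv r)) v))"

definition icanonical_basis ::
    "nat \<Rightarrow> 'v::ab_group_add set \<Rightarrow> (Uq \<Rightarrow> 'v \<Rightarrow> 'v) \<Rightarrow> 'v \<Rightarrow> nat \<Rightarrow> 'v" where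
  "icanonical_basis \<mu> V act v = (THE b. is_icanonical_basis \<mu> V act v b)"

text \<open>The element \<open>u\<^sub>a\<close> of the canonical basis of odd parity, relative to a family \<open>L\<close>, \<open>act\<close>, \<open>v\<close>
  of modules with highest weight vectors, indexed by the highest weight.\<close>
definition icanonical_odd ::
    "(nat \<Rightarrow> 'v::ab_group_add set) \<Rightarrow> (nat \<Rightarrow> Uq \<Rightarrow> 'v \<Rightarrow> 'v) \<Rightarrow> (nat \<Rightarrow> 'v) \<Rightarrow> nat \<Rightarrow> Uq" where
  "icanonical_odd L act v a = (THE u. u \<in> Uiota \<and>
     (\<forall>\<^sub>F l in sequentially. act (2 * l + 1) u (v (2 * l + 1)) =
        icanonical_basis (2 * l + 1) (L (2 * l + 1)) (act (2 * l + 1)) (v (2 * l + 1)) a))"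

end

theory Submission
  imports Defs
begin

text \<open>
  Put \<open>p = q\<^sup>-\<^sup>1\<close>, \<open>\<mu> = 2l + 1\<close> and \<open>w\<^sub>r = F\<^sup>(\<^sup>r\<^sup>) v\<close>. On the \<open>w\<^sub>r\<close> the element \<open>t\<close> acts by a tridiagonal
  matrix (\<open>t_Fdiv\<close>), and the recursion that defines the \<open>\<iota>\<close>-divided powers can be solved in closed
  form: \<open>t_odd n v\<close> is the sum over \<open>k\<close> of \<open>p\<^sup>e \<cdot> B \<cdot> w\<^sub>n\<^sub>-\<^sub>k\<close>, where \<open>B\<close> is the Gaussian binomial
  coefficient of \<open>N + k div 2\<close> over \<open>k div 2\<close> in the variable \<open>p\<^sup>4\<close>, and
    \<^item> for \<open>n = 2a\<close>: \<open>N = l + 1 - a\<close> and \<open>e = (k choose 2)\<close>, plus \<open>2N\<close> if \<open>k\<close> is odd;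
    \<^item> for \<open>n = 2a + 1\<close>: \<open>N = l - a\<close> and \<open>e = (k + 1 choose 2)\<close>, plus \<open>2N\<close> if \<open>k\<close> is odd.
  In both cases the recursion reduces to the two Pascal rules for Gaussian binomials and the ratio
  of neighbouring ones (\<open>icoeff_step\<close>, \<open>act_t_odd\<close>).

  Everything can be read off from this expansion. If \<open>n \<le> \<mu>\<close>, then the coefficient of \<open>w\<^sub>n\<close> is \<open>1\<close>, and
  \<open>e > 0\<close> for \<open>k > 0\<close>, so the other coefficients lie in \<open>p \<int>[p]\<close>. In particular the vectors
  \<open>t_odd n v\<close> with \<open>n \<le> \<mu>\<close> arise from the basis \<open>w\<^sub>0, \<dots>, w\<^sub>\<mu>\<close> by a unitriangular matrix, hence form a
  basis. The expansions for \<open>n = \<mu>\<close> and \<open>n = \<mu> + 1\<close> both have \<open>N = 0\<close> and coincide, because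
  \<open>w\<^sub>r = 0\<close> for \<open>r = \<mu> + 1\<close>; the recursion then makes all later vectors vanish. Hence conjugating the
  coordinates in the basis \<open>t_odd n v\<close> is a semilinear map that fixes \<open>t_odd n v\<close> for all \<open>n\<close>, and
  it is the only one: the bar involution exists and is unique. The vectors \<open>t_odd n v\<close> with \<open>n \<le> \<mu>\<close>
  therefore have both properties that characterize the \<open>\<iota>\<close>-canonical basis. No other family has
  them: a bar-invariant vector whose \<open>w\<close>-coordinates lie in \<open>p \<int>[p]\<close> is zero, because its leading
  coordinate is the same in the bases \<open>w\<^sub>r\<close> and \<open>t_odd n v\<close>, hence bar-invariant, and no nonzero
  element of \<open>p \<int>[p]\<close> is (\<open>lattice_bar_invariant_eq_0\<close>, \<open>icanonical_basis_eq\<close>).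

  For the algebra, the recursion shows that the \<open>t_odd n\<close> span \<open>U\<^sup>\<iota>\<close> (\<open>span_t_odd\<close>). A finite combination of
  them that kills the highest weight vectors of the modules of large odd weight is trivial,
  since those \<open>t_odd n v\<close> are independent. This gives independence in \<open>U\<^sup>\<iota>\<close> as well as the
  uniqueness of the element that lifts the \<open>a\<close>-th canonical basis vector.
\<close>

section \<open>Bar conjugation of rational functions\<close>

lemma map_poly_hom_add:
  fixes h :: "'a::comm_ring_1 \<Rightarrow> 'b::comm_ring_1"
  assumes "h 0 = 0" "\<And>a b. h (a + b) = h a + h b"
  shows "map_poly h (f + g) = map_poly h f + map_poly h g"
  by (simp add: poly_eq_iff coeff_map_poly assms)

lemma map_poly_hom_mult:
  fixes h :: "'a::comm_ring_1 \<Rightarrow> 'b::comm_ring_1"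
  assumes h: "h 0 = 0" "\<And>a b. h (a + b) = h a + h b" "\<And>a b. h (a * b) = h a * h b"
  shows "map_poly h (f * g) = map_poly h f * map_poly h g"
proof (induction f)
  case (pCons a f)
  have smult: "map_poly h (smult a g) = smult (h a) (map_poly h g)"
    by (simp add: poly_eq_iff coeff_map_poly h)
  show ?case
    using pCons by (simp add: map_poly_hom_add[OF h(1,2)] smult map_poly_pCons h)
qed (simp add: h)

lemma q_minus_inverse_nonzero: "q - inverse q \<noteq> 0"
  using q_power_neq_inverse[of 1] by simp

lemma rat_const_simps [simp]:
  "rat_const 0 = 0" "rat_const 1 = 1" "rat_const (a + b) = rat_const a + rat_const b"
  "rat_const (a * b) = rat_const a * rat_const b" "rat_const a = 0 \<longleftrightarrow> a = 0"
  by (simp_all add: rat_const_def Zero_fract_def One_fract_def one_pCons eq_fract)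

lemma rat_const_of_int: "rat_const (of_int n) = of_int n"
proof -
  have nat: "rat_const (of_nat m) = of_nat m" for m by (induction m) simp_all
  have neg: "rat_const (- a) = - rat_const a" for a
    using rat_const_simps(3)[of a "- a"] by (simp add: eq_neg_iff_add_eq_0 add.commute)
  show ?thesis by (cases n) (simp_all add: nat neg del: of_nat_Suc)
qed

definition eval_at :: "rat poly \<Rightarrow> ratfun \<Rightarrow> ratfun" where
  "eval_at f x = poly (map_poly rat_const f) x"

lemma eval_at_simps:
  "eval_at 0 x = 0" "eval_at 1 x = 1" "eval_at (f + g) x = eval_at f x + eval_at g x"
  "eval_at (f * g) x = eval_at f x * eval_at g x" "eval_at [:a:] x = rat_const a"
  "eval_at [:0, 1:] x = x"
  by (simp_all add: eval_at_def map_poly_hom_add map_poly_hom_mult map_poly_pCons one_pCons)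

lemma eval_at_diff: "eval_at (f - g) x = eval_at f x - eval_at g x"
  using eval_at_simps(3)[of "f - g" g x] by simp

lemma eval_at_q: "eval_at f q = Fract f 1"
  by (induction f)
    (simp_all add: eval_at_def map_poly_pCons rat_const_def q_def Zero_fract_def)

lemma eval_at_reflect:
  assumes "x \<noteq> 0"
  shows "eval_at (reflect_poly f) x = x ^ degree f * eval_at f (inverse x)"
proof -
  have d: "degree (map_poly rat_const f) = degree f"
    by (rule degree_map_poly) simp
  have "map_poly rat_const (reflect_poly f) = reflect_poly (map_poly rat_const f)"
    by (auto simp: poly_eq_iff coeff_map_poly coeff_reflect_poly d)
  then show ?thesis by (simp add: eval_at_def poly_reflect_poly_nz assms d)
qed

lemma eval_at_q_eq_0_iff: "eval_at f q = 0 \<longleftrightarrow> f = 0"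
  by (simp add: eval_at_q Zero_fract_def eq_fract)

text \<open>Both \<open>q\<close> and its inverse are transcendental over the rationals; for the inverse this follows by
reversing the order of the coefficients. Hence the substitution of the inverse for \<open>q\<close> extends to
quotients.\<close>
lemma eval_at_inverse_q_eq_0_iff: "eval_at f (inverse q) = 0 \<longleftrightarrow> f = 0"
proof
  assume "eval_at f (inverse q) = 0"
  then have "eval_at (reflect_poly f) q = 0" by (simp add: eval_at_reflect q_nonzero)
  then show "f = 0" by (simp add: eval_at_q_eq_0_iff)
qed (simp add: eval_at_simps)

text \<open>The field automorphism that fixes the rationals and exchanges \<open>q\<close> with its inverse. It is given
through an arbitrary representation as a fraction; \<open>bar_Fract\<close> shows that the choice is
immaterial.\<close>
definition bar :: "ratfun \<Rightarrow> ratfun" where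
  "bar x = (THE y. \<exists>a b. b \<noteq> 0 \<and> x = Fract a b \<and>
     y = eval_at a (inverse q) / eval_at b (inverse q))"

lemma bar_Fract:
  assumes "b \<noteq> 0"
  shows "bar (Fract a b) = eval_at a (inverse q) / eval_at b (inverse q)"
  unfolding bar_def
proof (rule the_equality)
  fix y
  assume "\<exists>c d. d \<noteq> 0 \<and> Fract a b = Fract c d \<and>
    y = eval_at c (inverse q) / eval_at d (inverse q)"
  then obtain c d where d: "d \<noteq> 0" "Fract a b = Fract c d"
    and y: "y = eval_at c (inverse q) / eval_at d (inverse q)"
    by blast
  then have "c * b = a * d" using assms by (simp add: eq_fract)
  then have "eval_at c (inverse q) * eval_at b (inverse q)
      = eval_at a (inverse q) * eval_at d (inverse q)"
    by (simp flip: eval_at_simps)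
  then show "y = eval_at a (inverse q) / eval_at b (inverse q)"
    using assms d(1) by (simp add: y eval_at_inverse_q_eq_0_iff frac_eq_eq)
qed (use assms in blast)

lemma bar_add: "bar (x + y) = bar x + bar y"
  by (cases x; cases y)
    (simp add: bar_Fract eval_at_simps eval_at_inverse_q_eq_0_iff add_frac_eq mult.commute)

lemma bar_mult: "bar (x * y) = bar x * bar y"
  by (cases x; cases y)
    (simp add: bar_Fract eval_at_simps eval_at_inverse_q_eq_0_iff field_simps)

lemma bar_rat_const: "bar (rat_const a) = rat_const a"
  using bar_Fract[of 1 "[:a:]"] by (simp add: eval_at_simps rat_const_def)

lemma bar_0: "bar 0 = 0"
  using bar_rat_const[of 0] by simp

lemma bar_1: "bar 1 = 1"
  using bar_rat_const[of 1] by simp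

lemma bar_q: "bar q = inverse q"
  using bar_Fract[of 1 "[:0, 1:]"] by (simp add: eval_at_simps flip: q_def)

lemma bar_inverse_q: "bar (inverse q) = q"
  using bar_mult[of q "inverse q"] q_nonzero by (simp add: bar_q bar_1 field_simps)

lemma bar_eval_at: "bar (eval_at f x) = eval_at f (bar x)"
  by (induction f) (simp_all add: eval_at_def map_poly_pCons bar_add bar_mult bar_rat_const bar_0)

lemma ratfun_quotient_cases:
  obtains a b where "b \<noteq> 0" "x = eval_at a q / eval_at b q"
  by (cases x) (auto simp: eval_at_q)

lemma qinv_int_polys_eval_at:
  assumes "x \<in> qinv_int_polys"
  obtains f where "x = inverse q * eval_at f (inverse q)"
proof -
  from assms obtain p :: "int poly" where p: "x = inverse q * poly (map_poly of_int p) (inverse q)"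
    by (auto simp: qinv_int_polys_def)
  have "map_poly rat_const (map_poly of_int p) = map_poly of_int p"
    by (simp add: poly_eq_iff coeff_map_poly rat_const_of_int)
  then show ?thesis using p that by (metis eval_at_def)
qed

text \<open>An element of \<open>q\<^sup>-\<^sup>1 \<int>[q\<^sup>-\<^sup>1]\<close> has only negative powers of \<open>q\<close> and its conjugate only positive ones, so
a bar-invariant one is zero. The statement is about a difference because the difference of two
canonical bases is what it is applied to.\<close>
lemma bar_invariant_diff_eq_0:
  assumes "x \<in> qinv_int_polys" "y \<in> qinv_int_polys" "bar (x - y) = x - y"
  shows "x = y"
proof -
  obtain f g where "x = inverse q * eval_at f (inverse q)" "y = inverse q * eval_at g (inverse q)"
    using assms(1,2) by (metis qinv_int_polys_eval_at)
  then have z: "x - y = inverse q * eval_at (f - g) (inverse q)"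
    by (simp add: eval_at_diff algebra_simps)
  define h where "h = f - g"
  have "q * eval_at h q = inverse q * eval_at h (inverse q)"
    using assms(3) unfolding z h_def by (simp add: bar_mult bar_inverse_q bar_eval_at)
  then have "q * q * eval_at h q = eval_at h (inverse q)" using q_nonzero by (simp add: field_simps)
  then have "q ^ degree h * (q * q * eval_at h q) = eval_at (reflect_poly h) q"
    by (simp add: eval_at_reflect q_nonzero)
  moreover have "q ^ degree h * (q * q * eval_at h q) = eval_at (monom 1 (degree h + 2) * h) q"
    unfolding eval_at_simps(4) eval_at_q[of "monom 1 _"] q_power[symmetric]
    by (simp add: power_add power2_eq_square mult_ac)
  ultimately have "eval_at (monom 1 (degree h + 2) * h - reflect_poly h) q = 0"
    by (simp add: eval_at_diff)
  then have eq: "monom 1 (degree h + 2) * h = reflect_poly h"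
    by (simp add: eval_at_q_eq_0_iff)
  \<comment> \<open>Multiplied by a power of \<open>q\<close>, invariance becomes an identity of polynomials with different degrees.\<close>
  have "h = 0"
  proof (rule ccontr)
    assume "h \<noteq> 0"
    then have "degree (monom 1 (degree h + 2) * h) = degree h + 2 + degree h"
      by (simp add: degree_mult_eq degree_monom_eq monom_eq_0_iff)
    then show False using eq degree_reflect_poly_le[of h] by simp
  qed
  then show ?thesis using z by (simp add: h_def eval_at_simps)
qed

definition int_polys_inv_q :: "ratfun set" where
  "int_polys_inv_q = {poly (map_poly of_int p) (inverse q) | p :: int poly. True}"

lemma int_polys_inv_q_add:
  "x \<in> int_polys_inv_q \<Longrightarrow> y \<in> int_polys_inv_q \<Longrightarrow> x + y \<in> int_polys_inv_q"
  unfolding int_polys_inv_q_def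
  by (clarsimp, rule exI, subst map_poly_hom_add) (auto simp: poly_add)

lemma int_polys_inv_q_mult:
  "x \<in> int_polys_inv_q \<Longrightarrow> y \<in> int_polys_inv_q \<Longrightarrow> x * y \<in> int_polys_inv_q"
  unfolding int_polys_inv_q_def
  by (clarsimp, rule exI, subst map_poly_hom_mult) (auto simp: poly_mult)

lemma int_polys_inv_q_1: "1 \<in> int_polys_inv_q"
  unfolding int_polys_inv_q_def by (auto intro!: exI[of _ 1])

lemma int_polys_inv_q_power: "inverse q ^ n \<in> int_polys_inv_q"
proof (induction n)
  case (Suc n)
  have "inverse q \<in> int_polys_inv_q"
    unfolding int_polys_inv_q_def by (auto intro!: exI[of _ "[:0, 1:]"] simp: map_poly_pCons)
  with Suc show ?case by (simp add: int_polys_inv_q_mult)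
qed (simp add: int_polys_inv_q_1)

lemma qinv_int_polys_power_mult:
  assumes "n > 0" "x \<in> int_polys_inv_q"
  shows "inverse q ^ n * x \<in> qinv_int_polys"
proof -
  have "inverse q ^ (n - 1) * x \<in> int_polys_inv_q"
    by (intro int_polys_inv_q_mult int_polys_inv_q_power assms)
  moreover have "inverse q ^ n * x = inverse q * (inverse q ^ (n - 1) * x)"
    using assms(1) by (cases n) simp_all
  ultimately show ?thesis by (auto simp: int_polys_inv_q_def qinv_int_polys_def)
qed

lemma qinv_int_polys_0: "0 \<in> qinv_int_polys"
  unfolding qinv_int_polys_def by (auto intro!: exI[of _ 0])

section \<open>Gaussian binomial coefficients\<close>

abbreviation (input) Q4 :: ratfun where "Q4 \<equiv> inverse q ^ 4"

text \<open>In the variable \<open>q\<^sup>-\<^sup>4\<close>, \<open>gauss N j\<close> is the Gaussian binomial coefficient of \<open>N + j\<close> over \<open>j\<close>. This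
indexing keeps all arguments natural numbers, and the defining Pascal rule makes it evident that
the values are polynomials in \<open>q\<^sup>-\<^sup>1\<close> with integer coefficients.\<close>
fun gauss :: "nat \<Rightarrow> nat \<Rightarrow> ratfun" where
  "gauss 0 j = 1"
| "gauss (Suc N) 0 = 1"
| "gauss (Suc N) (Suc j) = gauss N (Suc j) + Q4 ^ Suc N * gauss (Suc N) j"

lemma gauss_0_right [simp]: "gauss N 0 = 1"
  by (cases N) simp_all

lemma gauss_in_int_polys_inv_q: "gauss N j \<in> int_polys_inv_q"
  by (induction N j rule: gauss.induct)
    (auto intro!: int_polys_inv_q_add int_polys_inv_q_mult int_polys_inv_q_1 int_polys_inv_q_power
      simp flip: power_mult power_Suc power_add)

text \<open>The quotient of neighbours in the second argument. The induction on the first argument runs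
together with the analogous rule for neighbours in that argument, which is the inner claim.\<close>
lemma gauss_ratio: "(1 - Q4 ^ Suc j) * gauss N (Suc j) = (1 - Q4 ^ (N + Suc j)) * gauss N j"
proof (induction N arbitrary: j)
  case (Suc N)
  have B: "(1 - Q4 ^ Suc N) * gauss (Suc N) j = (1 - Q4 ^ (N + Suc j)) * gauss N j" for j
  proof (induction j)
    case (Suc j)
    define X Y Z W where XYZ: "X = gauss N (Suc j)" "Y = gauss (Suc N) j" "Z = gauss N j"
      and W: "W = gauss (Suc N) (Suc j)"
    define A B where AB: "A = Q4 ^ j" "B = Q4 ^ N"
    have "W = X + B * Q4 * Y" by (simp add: W XYZ AB)
    moreover have "(1 - B * Q4) * Y = (1 - A * B * Q4) * Z"
      using Suc by (simp add: XYZ AB power_add mult_ac)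
    moreover have "(1 - A * Q4) * X = (1 - A * B * Q4) * Z"
      using \<open>\<And>j. (1 - Q4 ^ Suc j) * gauss N (Suc j) = _\<close>[of j] by (simp add: XYZ AB power_add mult_ac)
    ultimately have "(1 - B * Q4) * W = (1 - A * B * Q4 * Q4) * X" by algebra
    then show ?case by (simp add: XYZ W AB power_add mult_ac)
  qed simp
  define X Y Z W where XYZ: "X = gauss N (Suc j)" "Y = gauss (Suc N) j" "Z = gauss N j"
    and W: "W = gauss (Suc N) (Suc j)"
  define A B where AB: "A = Q4 ^ j" "B = Q4 ^ N"
  have "W = X + B * Q4 * Y" by (simp add: W XYZ AB)
  moreover have "(1 - B * Q4) * Y = (1 - A * B * Q4) * Z"
    using B[of j] by (simp add: XYZ AB power_add mult_ac)
  moreover have "(1 - A * Q4) * X = (1 - A * B * Q4) * Z"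
    using Suc[of j] by (simp add: XYZ AB power_add mult_ac)
  ultimately have "(1 - A * Q4) * W = (1 - A * B * Q4 * Q4) * Y" by algebra
  then show ?case by (simp add: XYZ W AB power_add mult_ac)
qed simp

text \<open>The mirror image of the defining recursion. The step to an \<open>\<iota>\<close>-divided power of odd index uses both
Pascal rules, the step to one of even index uses the ratio.\<close>
lemma gauss_pascal: "gauss (Suc N) (Suc j) = Q4 ^ Suc j * gauss N (Suc j) + gauss (Suc N) j"
proof -
  define A B X Y Z where defs: "A = Q4 ^ j" "B = Q4 ^ N" "X = gauss N (Suc j)"
    "Y = gauss (Suc N) j" "Z = gauss (Suc N) (Suc j)"
  have "Z = X + B * Q4 * Y" by (simp add: defs)
  moreover have "(1 - A * Q4) * Z = (1 - A * B * Q4 * Q4) * Y"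
    using gauss_ratio[of j "Suc N"] by (simp add: defs power_add mult_ac del: gauss.simps)
  ultimately have "Z = A * Q4 * X + Y" by algebra
  then show ?thesis by (simp add: defs mult_ac del: gauss.simps)
qed

section \<open>Quantum integers and the quantum group\<close>

lemma q_powi_eq_iff: "q powi m = q powi n \<longleftrightarrow> m = n"
proof
  assume eq: "q powi m = q powi n"
  define k where "k = \<bar>m\<bar> + \<bar>n\<bar>"
  have "q powi (m + k) = q powi (n + k)"
    using eq q_nonzero by (simp add: power_int_add)
  then have "q ^ nat (m + k) = q ^ nat (n + k)"
    by (simp add: power_int_def k_def split: if_splits)
  then show "m = n" by (simp add: q_power_eq_iff k_def split: if_splits)
qed simp

lemma qint_eq_0_iff: "qint n = 0 \<longleftrightarrow> n = 0"
  using q_powi_eq_iff[of n "- n"] q_minus_inverse_nonzero by (auto simp: qint_def)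

lemma qint_0 [simp]: "qint 0 = 0"
  by (simp add: qint_eq_0_iff)

text \<open>The scalar that makes the induction for the action of \<open>E\<close> work: commuting \<open>E\<close> past one more
factor \<open>F\<close> adds the last summand.\<close>
lemma qint_identity:
  "qint (r + 1) * qint (m - r) = qint r * qint (m - r + 1) + qint (m - 2 * r)"
proof -
  define A where "A = q powi r"
  define M where "M = q powi m"
  have nz: "A \<noteq> 0" "M \<noteq> 0" using q_nonzero by (simp_all add: A_def M_def)
  define d where "d = inverse (q - inverse q)"
  have d: "d * (q - inverse q) = 1" using q_minus_inverse_nonzero by (simp add: d_def)
  define Ai Mi qi where "Ai = inverse A" "Mi = inverse M" "qi = inverse q"
  have i: "A * Ai = 1" "M * Mi = 1" "q * qi = 1"
    using nz q_nonzero by (simp_all add: Ai_Mi_qi_def)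
  have A2: "q powi (2 * r) = A * A"
    using q_nonzero unfolding mult_2 A_def by (rule power_int_add[OF disjI1])
  have e: "qint (r + 1) = (A * q - Ai * qi) * d" "qint (m - r) = (M * Ai - A * Mi) * d"
    "qint r = (A - Ai) * d" "qint (m - r + 1) = (M * Ai * q - A * Mi * qi) * d"
    "qint (m - 2 * r) = (M * Ai * Ai - A * A * Mi) * d"
    using q_nonzero unfolding qint_def
    by (simp_all add: power_int_add power_int_diff power_int_minus divide_inverse mult_ac
        A2[unfolded mult.commute[of 2 r]] Ai_Mi_qi_def d_def flip: A_def M_def)
  have d': "d * (q - qi) = 1" using d by (simp add: Ai_Mi_qi_def)
  have "(A * q - Ai * qi) * (M * Ai - A * Mi) =
      (A - Ai) * (M * Ai * q - A * Mi * qi) + (M * Ai * Ai - A * A * Mi) * (q - qi)"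
    using i(1) mult.assoc[of A Ai, symmetric] by (simp add: algebra_simps)
  with d' show ?thesis unfolding e by algebra
qed

lemma scaleU_mult_left: "scaleU c x * y = scaleU c (x * y)"
  by (simp add: scaleU_def mult.assoc)

lemma scaleU_mult_right: "x * scaleU c y = scaleU c (x * y)"
  by (metis UScal_central mult.assoc scaleU_def)

lemmas scaleU_mult = scaleU_mult_left scaleU_mult_right

lemma UScal_eq_scaleU: "UScal c = scaleU c 1"
  by (simp add: scaleU_def)

lemma Fdiv_0: "Fdiv 0 = 1"
  by (simp add: Fdiv_def qfact_def)

lemma UF_Fdiv: "UF * Fdiv r = scaleU (qint (int r + 1)) (Fdiv (Suc r))"
proof -
  have "qfact (Suc r) = qfact r * qint (int r + 1)"
    by (simp add: qfact_def add.commute)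
  moreover have "qint (int r + 1) \<noteq> 0" by (simp add: qint_eq_0_iff)
  ultimately show ?thesis by (simp add: Fdiv_def scaleU_mult)
qed

lemma Fdiv_Suc: "Fdiv (Suc r) = scaleU (inverse (qint (int r + 1))) (UF * Fdiv r)"
  by (simp add: UF_Fdiv qint_eq_0_iff)

lemma UK_UF_scaleU: "UK * UF = scaleU (inverse (q\<^sup>2)) (UF * UK)"
  by (simp add: scaleU_def UK_UF)

lemma Uq_induct [case_names scal E F K Kinv add mult]:
  assumes "\<And>c. P (UScal c)" "P UE" "P UF" "P UK" "P UKinv"
    "\<And>x y. P x \<Longrightarrow> P y \<Longrightarrow> P (x + y)" "\<And>x y. P x \<Longrightarrow> P y \<Longrightarrow> P (x * y)"
  shows "P u"
proof (induction u rule: Uq.abs_induct)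
  case (1 e)
  show ?case
    by (induction e)
      (use assms in \<open>simp_all flip: UScal.abs_eq UE.abs_eq UF.abs_eq UK.abs_eq UKinv.abs_eq
        plus_Uq.abs_eq times_Uq.abs_eq\<close>)
qed

lemma Uq_span_imageD:
  assumes "x \<in> Uq.span (f ` A)"
  obtains F c where "finite F" "F \<subseteq> A" "x = (\<Sum>i\<in>F. scaleU (c i) (f i))"
proof -
  obtain S r where S: "finite S" "S \<subseteq> f ` A" "x = (\<Sum>a\<in>S. scaleU (r a) a)"
    using assms unfolding Uq.span_explicit by blast
  then obtain B where B: "B \<subseteq> A" "inj_on f B" "S = f ` B"
    unfolding subset_image_inj by blast
  show ?thesis
  proof (rule that[of B "\<lambda>i. r (f i)"])
    show "finite B" using B S(1) finite_imageD by blast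
    show "x = (\<Sum>i\<in>B. scaleU (r (f i)) (f i))"
      using S(3) B(2,3) by (simp add: sum.reindex)
  qed (use B in auto)
qed

lemma Uq_span_image_finiteD:
  assumes "finite A" "x \<in> Uq.span (f ` A)"
  obtains c where "x = (\<Sum>i\<in>A. scaleU (c i) (f i))"
proof -
  obtain F c where F: "finite F" "F \<subseteq> A" "x = (\<Sum>i\<in>F. scaleU (c i) (f i))"
    using assms(2) by (rule Uq_span_imageD)
  have "x = (\<Sum>i\<in>A. scaleU (if i \<in> F then c i else 0) (f i))"
    unfolding F(3) using F(1,2) assms(1) by (intro sum.mono_neutral_cong_left) auto
  then show ?thesis by (rule that)
qed

section \<open>Divided powers acting on a highest weight vector\<close>

context simple_highest_weight_module
begin

lemma act_0: "act 0 v = 0"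
  using act_add_left[OF hwv_closed, of 0 0] by simp

lemma act_sum: "act (\<Sum>i\<in>A. f i) v = (\<Sum>i\<in>A. act (f i) v)"
  by (induction A rule: infinite_finite_induct)
    (simp_all add: act_0 act_add_left[OF hwv_closed])

lemma act_diff: "act (x - y) v = act x v - act y v"
  using act_add_left[OF hwv_closed, of "x - y" y] by (simp add: algebra_simps)

lemma act_closed': "act x v \<in> V"
  by (rule act_closed[OF hwv_closed])

text \<open>With the vector \<open>v\<close> fixed, computations take place in the algebra, up to equality of the action on
\<open>v\<close>. This relation is a left congruence, and no membership conditions have to be carried along.\<close>
lemma act_cong_mult: "act x v = act y v \<Longrightarrow> act (u * x) v = act (u * y) v"
  by (simp add: act_mult[OF hwv_closed])

lemma act_cong_scale: "act x v = act y v \<Longrightarrow> act (scaleU c x) v = act (scaleU c y) v"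
  unfolding scaleU_def by (rule act_cong_mult)

lemma act_cong_sum:
  "(\<And>i. i \<in> A \<Longrightarrow> act (f i) v = act (g i) v) \<Longrightarrow> act (\<Sum>i\<in>A. f i) v = act (\<Sum>i\<in>A. g i) v"
  by (simp add: act_sum cong: sum.cong)

lemma act_scale_eq_0_iff: "act (scaleU c x) v = 0 \<longleftrightarrow> c = 0 \<or> act x v = 0"
proof (cases "c = 0")
  case False
  have "act x v = 0" if "act (scaleU c x) v = 0"
    using act_cong_scale[of "scaleU c x" 0 "inverse c"] False that by (simp add: act_0)
  moreover have "act (scaleU c x) v = 0" if "act x v = 0"
    using act_cong_scale[of x 0] that by (simp add: act_0)
  ultimately show ?thesis using False by blast
qed (simp add: act_0)

lemma act_UScal_eq_0_iff: "act (UScal c) v = 0 \<longleftrightarrow> c = 0"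
  by (simp add: UScal_eq_scaleU act_scale_eq_0_iff act_one hwv_closed hwv_nonzero)

lemma K_Fdiv: "act (UK * Fdiv r) v = act (scaleU (q powi (int \<mu> - 2 * int r)) (Fdiv r)) v"
proof (induction r)
  case 0
  then show ?case using K_hwv by (simp add: Fdiv_0 UScal_eq_scaleU)
next
  case (Suc r)
  define c where "c = inverse (qint (int r + 1))"
  have "UK * Fdiv (Suc r) = scaleU (c * inverse (q\<^sup>2)) (UF * (UK * Fdiv r))"
    by (simp add: Fdiv_Suc c_def scaleU_mult UK_UF_scaleU mult.assoc[symmetric])
  then have "act (UK * Fdiv (Suc r)) v = act (scaleU (c * inverse (q\<^sup>2))
      (UF * scaleU (q powi (int \<mu> - 2 * int r)) (Fdiv r))) v"
    using act_cong_scale[OF act_cong_mult[OF Suc]] by simp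
  also have "scaleU (c * inverse (q\<^sup>2)) (UF * scaleU (q powi (int \<mu> - 2 * int r)) (Fdiv r)) =
      scaleU (q powi (int \<mu> - 2 * int r) * inverse (q\<^sup>2)) (Fdiv (Suc r))"
    by (simp add: Fdiv_Suc c_def scaleU_mult mult_ac)
  also have "q powi (int \<mu> - 2 * int r) * inverse (q\<^sup>2) = q powi (int \<mu> - 2 * int (Suc r))"
    using q_nonzero by (simp add: power_int_diff power_int_add field_simps power2_eq_square)
  finally show ?case .
qed

lemma Kinv_Fdiv: "act (UKinv * Fdiv r) v = act (scaleU (q powi (2 * int r - int \<mu>)) (Fdiv r)) v"
proof -
  let ?c = "q powi (int \<mu> - 2 * int r)"
  have "act (UKinv * (UK * Fdiv r)) v = act (UKinv * scaleU ?c (Fdiv r)) v"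
    by (rule act_cong_mult) (rule K_Fdiv)
  then have "act (Fdiv r) v = act (scaleU ?c (UKinv * Fdiv r)) v"
    by (simp add: scaleU_mult UKinv_UK flip: mult.assoc)
  then have "act (scaleU (inverse ?c) (Fdiv r)) v = act (scaleU (inverse ?c) (scaleU ?c (UKinv * Fdiv r))) v"
    by (rule act_cong_scale)
  moreover have "scaleU (inverse ?c) (scaleU ?c (UKinv * Fdiv r)) = UKinv * Fdiv r"
    using q_nonzero by simp
  moreover have "inverse ?c = q powi (2 * int r - int \<mu>)"
    by (simp flip: power_int_minus)
  ultimately show ?thesis by metis
qed

lemma E_Fdiv:
  "act (UE * Fdiv r) v =
    act (scaleU (qint (int \<mu> - int r + 1)) (if r = 0 then 0 else Fdiv (r - 1))) v"
proof (induction r)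
  case 0
  then show ?case using E_hwv by (simp add: Fdiv_0 act_0)
next
  case (Suc r)
  define c where "c = inverse (qint (int r + 1))"
  define d where "d = 1 / (q - inverse q)"
  have comm: "UE * UF = UF * UE + scaleU d (UK - UKinv)"
    using UE_UF by (simp add: scaleU_def d_def algebra_simps)
  have "UE * Fdiv (Suc r) = scaleU c (UE * UF * Fdiv r)"
    by (simp add: Fdiv_Suc c_def scaleU_mult mult.assoc)
  also have "\<dots> = scaleU c (UF * (UE * Fdiv r) + scaleU d (UK * Fdiv r - UKinv * Fdiv r))"
    unfolding comm by (simp add: distrib_right left_diff_distrib scaleU_mult mult.assoc)
  finally have "act (UE * Fdiv (Suc r)) v =
      act (scaleU c (UF * (UE * Fdiv r) + scaleU d (UK * Fdiv r - UKinv * Fdiv r))) v"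
    by simp
  also have "\<dots> = act (scaleU c (scaleU (qint (int \<mu> - int r + 1) * qint (int r)) (Fdiv r) +
      scaleU d (scaleU (q powi (int \<mu> - 2 * int r)) (Fdiv r) -
        scaleU (q powi (2 * int r - int \<mu>)) (Fdiv r)))) v"
  proof (rule act_cong_scale)
    have "act (UF * (UE * Fdiv r)) v =
        act (UF * scaleU (qint (int \<mu> - int r + 1)) (if r = 0 then 0 else Fdiv (r - 1))) v"
      by (rule act_cong_mult) (rule Suc)
    also have "UF * scaleU (qint (int \<mu> - int r + 1)) (if r = 0 then 0 else Fdiv (r - 1)) =
        scaleU (qint (int \<mu> - int r + 1) * qint (int r)) (Fdiv r)"
      by (cases r) (simp_all add: scaleU_mult UF_Fdiv add.commute)
    finally have 1: "act (UF * (UE * Fdiv r)) v =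
      act (scaleU (qint (int \<mu> - int r + 1) * qint (int r)) (Fdiv r)) v" .
    have 2: "act (scaleU d (UK * Fdiv r - UKinv * Fdiv r)) v =
      act (scaleU d (scaleU (q powi (int \<mu> - 2 * int r)) (Fdiv r) -
        scaleU (q powi (2 * int r - int \<mu>)) (Fdiv r))) v"
      by (rule act_cong_scale) (simp add: act_diff K_Fdiv Kinv_Fdiv)
    show "act (UF * (UE * Fdiv r) + scaleU d (UK * Fdiv r - UKinv * Fdiv r)) v =
      act (scaleU (qint (int \<mu> - int r + 1) * qint (int r)) (Fdiv r) +
      scaleU d (scaleU (q powi (int \<mu> - 2 * int r)) (Fdiv r) -
        scaleU (q powi (2 * int r - int \<mu>)) (Fdiv r))) v"
      by (simp add: act_add_left[OF hwv_closed] 1 2)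
  qed
  also have "scaleU c (scaleU (qint (int \<mu> - int r + 1) * qint (int r)) (Fdiv r) +
      scaleU d (scaleU (q powi (int \<mu> - 2 * int r)) (Fdiv r) -
        scaleU (q powi (2 * int r - int \<mu>)) (Fdiv r))) =
      scaleU (c * (qint (int r) * qint (int \<mu> - int r + 1) + qint (int \<mu> - 2 * int r))) (Fdiv r)"
  proof -
    have "qint (int \<mu> - 2 * int r) = d * (q powi (int \<mu> - 2 * int r) - q powi (2 * int r - int \<mu>))"
      by (simp add: qint_def d_def)
    then show ?thesis
      by (simp only: Uq.scale_right_distrib Uq.scale_right_diff_distrib Uq.scale_left_distrib
        Uq.scale_left_diff_distrib Uq.scale_scale distrib_left right_diff_distrib mult_ac)
  qed
  also have "qint (int r) * qint (int \<mu> - int r + 1) + qint (int \<mu> - 2 * int r)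
      = qint (int r + 1) * qint (int \<mu> - int r)"
    by (simp add: qint_identity)
  finally show ?case by (simp add: c_def qint_eq_0_iff mult.assoc[symmetric])
qed

text \<open>The highest weight vector is not a combination of \<open>F\<^sup>(\<^sup>r\<^sup>) v\<close> with \<open>r > \<mu>\<close>, because these have
other weights: applying \<open>K\<close> minus its eigenvalue on the last of them removes the last summand and
multiplies \<open>d\<close> by a nonzero scalar.\<close>
lemma hwv_not_in_lower_weights:
  assumes "act (\<Sum>r\<in>{\<mu><..R}. scaleU (c r) (Fdiv r)) v = act (UScal d) v"
  shows "d = 0"
  using assms
proof (induction R arbitrary: c d)
  case 0
  then show ?case by (simp add: act_0 act_UScal_eq_0_iff[of d])
next
  case (Suc R)
  show ?case
  proof (cases "\<mu> \<le> R")
    case False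
    then show ?thesis using Suc.prems by (simp add: act_0 act_UScal_eq_0_iff[of d])
  next
    case True
    define ev where "ev r = q powi (int \<mu> - 2 * int r)" for r
    define y where "y = UK - UScal (ev (Suc R))"
    have y: "act (y * Fdiv r) v = act (scaleU (ev r - ev (Suc R)) (Fdiv r)) v" for r
      by (simp add: y_def left_diff_distrib act_diff K_Fdiv ev_def Uq.scale_left_diff_distrib
        scaleU_def[symmetric])
    have "act (\<Sum>r\<in>{\<mu><..R}. scaleU (c r * (ev r - ev (Suc R))) (Fdiv r)) v =
        act (\<Sum>r\<in>{\<mu><..Suc R}. scaleU (c r) (scaleU (ev r - ev (Suc R)) (Fdiv r))) v"
      using True
      by (intro arg_cong2[where f = act] sum.mono_neutral_cong_left) (auto simp: le_Suc_eq)
    also have "\<dots> = act (\<Sum>r\<in>{\<mu><..Suc R}. scaleU (c r) (y * Fdiv r)) v"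
      by (intro act_cong_sum act_cong_scale) (simp add: y)
    also have "\<dots> = act (y * (\<Sum>r\<in>{\<mu><..Suc R}. scaleU (c r) (Fdiv r))) v"
      by (simp add: sum_distrib_left scaleU_mult)
    also have "\<dots> = act (y * UScal d) v"
      using Suc.prems by (rule act_cong_mult)
    also have "y * UScal d = scaleU d (y * Fdiv 0)"
      by (simp add: UScal_eq_scaleU scaleU_mult Fdiv_0)
    also have "act \<dots> v = act (scaleU d (scaleU (ev 0 - ev (Suc R)) (Fdiv 0))) v"
      by (intro act_cong_scale y)
    also have "scaleU d (scaleU (ev 0 - ev (Suc R)) (Fdiv 0)) = UScal (d * (ev 0 - ev (Suc R)))"
      by (simp add: UScal_eq_scaleU Fdiv_0)
    finally have "d * (ev 0 - ev (Suc R)) = 0" by (rule Suc.IH)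
    then have "d = 0 \<or> ev 0 = ev (Suc R)" by simp
    then show ?thesis by (auto simp: ev_def q_powi_eq_iff simp del: power_int_of_nat)
  qed
qed

text \<open>The form in which simplicity is used. To be stable under the whole algebra, the span of a set need
only be stable under the generators.\<close>
lemma submodule_spanned_by_orbit:
  assumes gens: "\<And>g s. g \<in> {UE, UF, UK, UKinv} \<Longrightarrow> s \<in> S \<Longrightarrow> \<exists>y\<in>Uq.span S. act (g * s) v = act y v"
  shows "(\<lambda>u. act u v) ` Uq.span S = {0} \<or> (\<lambda>u. act u v) ` Uq.span S = V"
proof (rule simple)
  let ?W = "(\<lambda>u. act u v) ` Uq.span S"
  show "?W \<subseteq> V" by (auto simp: act_closed')
  have gen: "\<exists>y\<in>Uq.span S. act (g * x) v = act y v"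
    if g: "g \<in> {UE, UF, UK, UKinv}" and "x \<in> Uq.span S" for g x
    using that(2)
  proof (induction rule: Uq.span_induct_alt)
    case base
    then show ?case using Uq.span_zero by (intro bexI[of _ 0]) simp_all
  next
    case (step c s x)
    obtain y z where "y \<in> Uq.span S" "act (g * s) v = act y v" "z \<in> Uq.span S" "act (g * x) v = act z v"
      using gens[OF g step(1)] step(2) by blast
    moreover have "act (scaleU c (g * s)) v = act (scaleU c y) v"
      by (rule act_cong_scale) fact
    ultimately have "act (g * (scaleU c s + x)) v = act (scaleU c y + z) v"
      by (simp add: distrib_left scaleU_mult act_add_left[OF hwv_closed])
    then show ?case
      using \<open>y \<in> _\<close> \<open>z \<in> _\<close> by (blast intro: Uq.span_add Uq.span_scale)
  qed
  have closed: "\<forall>x\<in>Uq.span S. \<exists>y\<in>Uq.span S. act (u * x) v = act y v" for u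
  proof (induction u rule: Uq_induct)
    case (scal c)
    show ?case using Uq.span_scale[of _ S c] by (auto simp flip: scaleU_def)
  next
    case (add u w)
    show ?case
    proof
      fix x assume x: "x \<in> Uq.span S"
      obtain y z where "y \<in> Uq.span S" "act (u * x) v = act y v" "z \<in> Uq.span S" "act (w * x) v = act z v"
        using add x by blast
      then show "\<exists>y\<in>Uq.span S. act ((u + w) * x) v = act y v"
        by (intro bexI[of _ "y + z"])
          (simp_all add: distrib_right act_add_left[OF hwv_closed] Uq.span_add)
    qed
  next
    case (mult u w)
    then show ?case by (metis act_cong_mult mult.assoc)
  qed (use gen in blast)+
  show "Uq_module ?W act"
  proof unfold_locales
    show "0 \<in> ?W" using act_0 Uq.span_zero by force
    show "x + y \<in> ?W" if "x \<in> ?W" "y \<in> ?W" for x y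
      using that Uq.span_add by (force simp flip: act_add_left[OF hwv_closed])
    show "act u x \<in> ?W" if "x \<in> ?W" for u x
      using that closed by (force simp flip: act_mult[OF hwv_closed])
  qed (auto simp: act_closed' act_add_left act_add_right act_mult act_one)
qed

text \<open>The vectors \<open>F\<^sup>(\<^sup>r\<^sup>) v\<close> with \<open>r > \<mu>\<close> span a submodule, since the coefficient with which \<open>E\<close>
would lead from \<open>r = \<mu> + 1\<close> back to \<open>r = \<mu>\<close> is \<open>[0] = 0\<close>. It does not contain \<open>v\<close>, so it is zero by
simplicity.\<close>
lemma Fdiv_Suc_weight_eq_0: "act (Fdiv (Suc \<mu>)) v = 0"
proof -
  let ?S = "Fdiv ` {\<mu><..}"
  have "(\<lambda>u. act u v) ` Uq.span ?S = {0} \<or> (\<lambda>u. act u v) ` Uq.span ?S = V"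
  proof (rule submodule_spanned_by_orbit)
    fix g s assume "g \<in> {UE, UF, UK, UKinv}" "s \<in> ?S"
    then obtain r where r: "s = Fdiv r" "r > \<mu>" by auto
    have mem: "Fdiv i \<in> Uq.span ?S" if "i > \<mu>" for i
      using that by (simp add: Uq.span_base)
    have "scaleU (qint (int \<mu> - int r + 1)) (if r = 0 then 0 else Fdiv (r - 1)) \<in> Uq.span ?S"
    proof (cases "r = Suc \<mu>")
      case False
      then show ?thesis using r(2) by (auto intro!: Uq.span_scale mem)
    qed (simp add: Uq.span_zero)
    moreover have "scaleU c (Fdiv r) \<in> Uq.span ?S" "scaleU c (Fdiv (Suc r)) \<in> Uq.span ?S" for c
      using r(2) by (auto intro!: Uq.span_scale mem)
    ultimately show "\<exists>y\<in>Uq.span ?S. act (g * s) v = act y v"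
      using \<open>g \<in> _\<close> unfolding r(1) by (auto simp: UF_Fdiv K_Fdiv Kinv_Fdiv E_Fdiv)
  qed
  moreover have "(\<lambda>u. act u v) ` Uq.span ?S \<noteq> V"
  proof
    assume "(\<lambda>u. act u v) ` Uq.span ?S = V"
    then have "v \<in> (\<lambda>u. act u v) ` Uq.span ?S" using hwv_closed by simp
    then obtain x where x: "v = act x v" "x \<in> Uq.span ?S" by (rule imageE)
    from x(2) obtain F c where F: "finite F" "F \<subseteq> {\<mu><..}" "x = (\<Sum>r\<in>F. scaleU (c r) (Fdiv r))"
      by (rule Uq_span_imageD)
    obtain R where R: "F \<subseteq> {..R}" using F(1) finite_nat_iff_bounded_le by blast
    have "x = (\<Sum>r\<in>{\<mu><..R}. scaleU (if r \<in> F then c r else 0) (Fdiv r))"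
      unfolding F(3) using F(1,2) R by (intro sum.mono_neutral_cong_left) auto
    then have "act (\<Sum>r\<in>{\<mu><..R}. scaleU (if r \<in> F then c r else 0) (Fdiv r)) v = act (UScal 1) v"
      using x(1) by (metis UScal_1 act_one hwv_closed)
    then have "(1::ratfun) = 0" by (rule hwv_not_in_lower_weights)
    then show False by simp
  qed
  moreover have "Fdiv (Suc \<mu>) \<in> Uq.span ?S" by (simp add: Uq.span_base)
  ultimately show ?thesis by blast
qed

lemma Fdiv_spanning:
  assumes "x \<in> V"
  obtains c where "x = act (\<Sum>r\<le>\<mu>. scaleU (c r) (Fdiv r)) v"
proof -
  let ?S = "Fdiv ` {..\<mu>}"
  have "(\<lambda>u. act u v) ` Uq.span ?S = {0} \<or> (\<lambda>u. act u v) ` Uq.span ?S = V"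
  proof (rule submodule_spanned_by_orbit)
    fix g s assume "g \<in> {UE, UF, UK, UKinv}" "s \<in> ?S"
    then obtain r where r: "s = Fdiv r" "r \<le> \<mu>" by auto
    have mem: "scaleU c (Fdiv i) \<in> Uq.span ?S" if "i \<le> \<mu>" for i c
      using that by (simp add: Uq.span_base Uq.span_scale)
    have "\<exists>y\<in>Uq.span ?S. act (UF * Fdiv r) v = act y v"
    proof (cases "r = \<mu>")
      case True
      then have "act (UF * Fdiv r) v = act 0 v"
        by (simp add: UF_Fdiv act_scale_eq_0_iff Fdiv_Suc_weight_eq_0 act_0)
      then show ?thesis using Uq.span_zero by blast
    next
      case False
      then show ?thesis using r(2) mem[of "Suc r"] by (auto simp: UF_Fdiv)
    qed
    moreover have "scaleU (qint (int \<mu> - int r + 1)) (if r = 0 then 0 else Fdiv (r - 1)) \<in> Uq.span ?S"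
      using r(2) mem[of "r - 1"] by (auto simp: Uq.span_zero)
    ultimately show "\<exists>y\<in>Uq.span ?S. act (g * s) v = act y v"
      using \<open>g \<in> _\<close> mem[OF r(2)] unfolding r(1) by (auto simp: K_Fdiv Kinv_Fdiv E_Fdiv)
  qed
  moreover have "act 1 v \<in> (\<lambda>u. act u v) ` Uq.span ?S"
    using Uq.span_base[of "Fdiv 0" ?S] by (force simp: Fdiv_0)
  ultimately have "(\<lambda>u. act u v) ` Uq.span ?S = V"
    using act_one[OF hwv_closed] hwv_nonzero by auto
  then obtain u where u: "u \<in> Uq.span ?S" "x = act u v" using assms by blast
  from finite_atMost u(1) obtain c where "u = (\<Sum>r\<le>\<mu>. scaleU (c r) (Fdiv r))"
    by (rule Uq_span_image_finiteD)
  then show ?thesis using u(2) that by blast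
qed

text \<open>Applying \<open>E\<close> lowers all indices by one with nonzero factors, which reduces a relation of length
\<open>m + 1\<close> to one of length \<open>m\<close>.\<close>
lemma Fdiv_independent:
  assumes "m \<le> \<mu>" "act (\<Sum>r\<le>m. scaleU (c r) (Fdiv r)) v = 0" "r \<le> m"
  shows "c r = 0"
  using assms
proof (induction m arbitrary: c r)
  case 0
  then show ?case by (simp add: act_scale_eq_0_iff Fdiv_0 act_one hwv_closed hwv_nonzero)
next
  case (Suc m)
  have "act (\<Sum>r\<le>m. scaleU (c (Suc r) * qint (int \<mu> - int r)) (Fdiv r)) v
      = act (\<Sum>r\<le>m. scaleU (c (Suc r)) (UE * Fdiv (Suc r))) v"
    by (simp add: act_sum E_Fdiv act_cong_scale[OF E_Fdiv])
  also have "\<dots> = act (\<Sum>r\<le>Suc m. scaleU (c r) (UE * Fdiv r)) v"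
    by (simp add: sum.atMost_Suc_shift act_sum act_add_left[OF hwv_closed] act_0
      act_cong_scale[OF E_Fdiv] del: sum.atMost_Suc)
  also have "\<dots> = act (UE * (\<Sum>r\<le>Suc m. scaleU (c r) (Fdiv r))) v"
    by (simp add: sum_distrib_left scaleU_mult del: sum.atMost_Suc)
  also have "\<dots> = act (UE * 0) v"
    by (rule act_cong_mult) (use Suc.prems in \<open>simp add: act_0 del: sum.atMost_Suc\<close>)
  finally have "act (\<Sum>r\<le>m. scaleU (c (Suc r) * qint (int \<mu> - int r)) (Fdiv r)) v = 0"
    by (simp add: act_0)
  then have *: "c (Suc i) * qint (int \<mu> - int i) = 0" if "i \<le> m" for i
    using Suc.IH[of "\<lambda>r. c (Suc r) * qint (int \<mu> - int r)" i] Suc.prems(1) that by simp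
  have c: "c (Suc i) = 0" if "i \<le> m" for i
    using *[OF that] Suc.prems(1) that by (simp add: qint_eq_0_iff)
  have "act (\<Sum>r\<le>Suc m. scaleU (c r) (Fdiv r)) v = act (scaleU (c 0) (Fdiv 0)) v"
    unfolding sum.atMost_Suc_shift by (simp add: c)
  then have "c 0 = 0"
    using Suc.prems(2) by (simp add: act_scale_eq_0_iff Fdiv_0 act_one hwv_closed hwv_nonzero
      del: sum.atMost_Suc)
  then show ?case using c Suc.prems(3) by (cases r) auto
qed

lemma t_Fdiv:
  "act (t * Fdiv r) v = act (scaleU (q powi (2 * int r - int \<mu> - 1) * qint (int \<mu> - int r + 1))
      (if r = 0 then 0 else Fdiv (r - 1)) + scaleU (q powi (2 * int r - int \<mu>)) (Fdiv r) +
      scaleU (qint (int r + 1)) (Fdiv (Suc r))) v"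
proof -
  let ?k = "q powi (2 * int r - int \<mu>)"
  let ?e = "qint (int \<mu> - int r + 1)"
  let ?F = "if r = 0 then 0 else Fdiv (r - 1)"
  have "act (UE * (UKinv * Fdiv r)) v = act (UE * scaleU ?k (Fdiv r)) v"
    by (rule act_cong_mult) (rule Kinv_Fdiv)
  also have "UE * scaleU ?k (Fdiv r) = scaleU ?k (UE * Fdiv r)" by (simp add: scaleU_mult)
  also have "act \<dots> v = act (scaleU ?k (scaleU ?e ?F)) v"
    by (rule act_cong_scale) (rule E_Fdiv)
  finally have "act (scaleU (inverse q) (UE * (UKinv * Fdiv r))) v =
      act (scaleU (inverse q) (scaleU ?k (scaleU ?e ?F))) v"
    by (rule act_cong_scale)
  also have "scaleU (inverse q) (scaleU ?k (scaleU ?e ?F))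
      = scaleU (q powi (2 * int r - int \<mu> - 1) * ?e) ?F"
    using power_int_diff[of q "2 * int r - int \<mu>" 1] q_nonzero
    by (simp add: divide_inverse mult_ac)
  finally have E: "act (Echeck * Fdiv r) v = act (scaleU (q powi (2 * int r - int \<mu> - 1) * ?e) ?F) v"
    by (simp add: Echeck_def scaleU_mult mult.assoc)
  show ?thesis
    by (simp only: t_def distrib_right act_add_left[OF hwv_closed] E Kinv_Fdiv UF_Fdiv ac_simps)
qed

text \<open>The tridiagonal action of \<open>t\<close> on coordinates. In the summand for \<open>r = 0\<close> the term \<open>f (r - 1)\<close> is
harmless, since its factor is \<open>[0] = 0\<close>.\<close>
lemma t_sum_Fdiv:
  assumes f: "\<And>r. r > n \<Longrightarrow> f r = 0"
  shows "act (t * (\<Sum>r\<le>n. scaleU (f r) (Fdiv r))) v =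
    act (\<Sum>r\<le>Suc n. scaleU (q powi (2 * int r - int \<mu> + 1) * qint (int \<mu> - int r) * f (Suc r) +
      q powi (2 * int r - int \<mu>) * f r + qint (int r) * f (r - 1)) (Fdiv r)) v"
proof -
  let ?a = "\<lambda>r. q powi (2 * int r - int \<mu> - 1) * qint (int \<mu> - int r + 1)"
  let ?b = "\<lambda>r. q powi (2 * int r - int \<mu>)"
  have 1: "(\<Sum>r\<le>n. scaleU (f r * ?a r) (if r = 0 then 0 else Fdiv (r - 1))) =
      (\<Sum>r\<le>Suc n. scaleU (q powi (2 * int r - int \<mu> + 1) * qint (int \<mu> - int r) * f (Suc r)) (Fdiv r))"
    (is "_ = sum ?g _")
  proof -
    have "(\<Sum>r\<le>n. scaleU (f r * ?a r) (if r = 0 then 0 else Fdiv (r - 1))) = (\<Sum>r<n. ?g r)"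
      unfolding sum.atMost_shift by (simp add: algebra_simps)
    also have "\<dots> = (\<Sum>r\<le>Suc n. ?g r)"
      by (rule sum.mono_neutral_left) (auto simp: f)
    finally show ?thesis .
  qed
  have 2: "(\<Sum>r\<le>n. scaleU (f r * ?b r) (Fdiv r)) = (\<Sum>r\<le>Suc n. scaleU (?b r * f r) (Fdiv r))"
    by (simp add: f mult.commute)
  have 3: "(\<Sum>r\<le>n. scaleU (f r * qint (int r + 1)) (Fdiv (Suc r))) =
      (\<Sum>r\<le>Suc n. scaleU (qint (int r) * f (r - 1)) (Fdiv r))"
    unfolding sum.atMost_Suc_shift by (simp add: mult.commute add.commute)
  have "act (t * (\<Sum>r\<le>n. scaleU (f r) (Fdiv r))) v = act (\<Sum>r\<le>n. scaleU (f r) (t * Fdiv r)) v"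
    by (simp add: sum_distrib_left scaleU_mult)
  also have "\<dots> = act (\<Sum>r\<le>n. scaleU (f r) (scaleU (?a r) (if r = 0 then 0 else Fdiv (r - 1)) +
      scaleU (?b r) (Fdiv r) + scaleU (qint (int r + 1)) (Fdiv (Suc r)))) v"
    by (intro act_cong_sum act_cong_scale t_Fdiv)
  also have "(\<Sum>r\<le>n. scaleU (f r) (scaleU (?a r) (if r = 0 then 0 else Fdiv (r - 1)) +
      scaleU (?b r) (Fdiv r) + scaleU (qint (int r + 1)) (Fdiv (Suc r)))) =
      (\<Sum>r\<le>n. scaleU (f r * ?a r) (if r = 0 then 0 else Fdiv (r - 1))) +
      (\<Sum>r\<le>n. scaleU (f r * ?b r) (Fdiv r)) +
      (\<Sum>r\<le>n. scaleU (f r * qint (int r + 1)) (Fdiv (Suc r)))"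
    by (simp only: Uq.scale_right_distrib Uq.scale_scale sum.distrib)
  finally show ?thesis
    unfolding 1 2 3 by (simp only: Uq.scale_left_distrib sum.distrib)
qed

end

section \<open>Expansion of the \<open>\<iota>\<close>-divided powers\<close>

text \<open>The coefficient of \<open>F\<^sup>(\<^sup>n\<^sup>-\<^sup>k\<^sup>) v\<close> in \<open>t_odd n v\<close>, up to a change of parameters: for \<open>n = 2a\<close> it is
\<open>icoeff_even (l + 1 - a) k\<close> and for \<open>n = 2a + 1\<close> it is \<open>icoeff_odd (l - a) k\<close>. Separating \<open>N\<close> from \<open>n\<close>
turns the recursion into identities that hold for every integer \<open>n\<close>.\<close>
definition icoeff_even :: "nat \<Rightarrow> nat \<Rightarrow> ratfun" where
  "icoeff_even N k = inverse q ^ ((k choose 2) + (if odd k then 2 * N else 0)) * gauss N (k div 2)"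

definition icoeff_odd :: "nat \<Rightarrow> nat \<Rightarrow> ratfun" where
  "icoeff_odd N k = inverse q ^ ((Suc k choose 2) + (if odd k then 2 * N else 0)) * gauss N (k div 2)"

definition icoeff :: "nat \<Rightarrow> nat \<Rightarrow> nat \<Rightarrow> ratfun" where
  "icoeff l n r = (if r > n then 0
     else if even n then icoeff_even (l + 1 - n div 2) (n - r)
     else icoeff_odd (l - n div 2) (n - r))"

lemma q_powi_diff_nat: "q powi (m - int k) = q powi m * inverse q ^ k"
  using q_nonzero by (simp add: power_int_diff divide_inverse power_inverse)

lemma qint_diff_nat:
  "qint (n - int k) = (q powi n * inverse q ^ k - q powi (- n) * q ^ k) * inverse (q - inverse q)"
  using power_int_add[of q "int k" "- n"] q_nonzero
  by (simp add: qint_def divide_inverse q_powi_diff_nat)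

lemma qint_of_nat: "qint (int k) = (q ^ k - inverse q ^ k) * inverse (q - inverse q)"
  by (simp add: qint_def divide_inverse power_int_minus power_inverse)

lemma choose_two_Suc: "Suc k choose 2 = (k choose 2) + k"
  by (simp add: numeral_2_eq_2)

lemma zero_choose_two: "0 choose 2 = 0"
  by (simp add: numeral_2_eq_2)

lemma nat_parity_cases:
  fixes k :: nat
  obtains "k = 0" | "k = 1" | i where "k = 2 * i + 2" | i where "k = 2 * i + 3"
proof (cases "even k")
  case True
  then obtain m where "k = 2 * m" by blast
  then show ?thesis using that by (cases m) auto
next
  case False
  then obtain m where "k = 2 * m + 1" by (rule oddE)
  then show ?thesis using that by (cases m) auto
qed

text \<open>The recursion in the step from \<open>t_odd (n - 1)\<close> to \<open>t_odd n\<close> with \<open>n\<close> even. After \<open>q\<^sup>n\<close> and the powers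
of \<open>q\<close> with exponents linear in \<open>N\<close> and \<open>k\<close> are replaced by variables, each parity of \<open>k\<close> gives a
polynomial identity that is a multiple of the relation \<open>gauss_ratio\<close>.\<close>
lemma icoeff_even_step:
  fixes n :: int
  shows "qint n * icoeff_even N k = qint (n - int k) * icoeff_odd N k +
    (if k \<ge> 1 then q powi (n - 2 * int k - 2 * int N + 1) * icoeff_odd N (k - 1) else 0) +
    (if k \<ge> 2 then q powi (n - 2 * int k - 2 * int N + 2) * qint (2 * int N - 1 + int k) *
       icoeff_odd N (k - 2) else 0)"
proof -
  define p where "p = inverse q"
  define d where "d = inverse (q - p)"
  define X Xi Z Zi where "X = q powi n" "Xi = q powi (- n)" "Z = p ^ (2 * N)" "Zi = q ^ (2 * N)"
  note defs = this
  have rels: "q * p = 1" "d * (q - p) = 1" "X * Xi = 1" "Z * Zi = 1"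
    using q_nonzero q_minus_inverse_nonzero
    by (simp_all add: p_def d_def defs power_int_minus power_inverse)
  have qint_nk: "qint (n - int k) = (X * p ^ k - Xi * q ^ k) * d" for k
    by (simp add: qint_diff_nat defs p_def d_def)
  have qint_n: "qint n = (X - Xi) * d"
    using qint_nk[of 0] by simp
  have qint_nat: "qint (int k) = (q ^ k - p ^ k) * d" for k
    by (simp add: qint_of_nat d_def p_def)
  have powi: "q powi (n - int m) = X * p ^ m" for m
    by (simp add: q_powi_diff_nat defs p_def)
  consider "k = 0" | "k = 1" | i where "k = 2 * i + 2" | i where "k = 2 * i + 3"
    by (rule nat_parity_cases)
  then show ?thesis
  proof cases
    case 1
    then show ?thesis by (simp add: icoeff_even_def icoeff_odd_def numeral_2_eq_2)
  next
    case 2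
    have O: "icoeff_odd N k = p * Z" "icoeff_odd N (k - 1) = 1" "icoeff_even N k = Z"
      using 2 by (simp_all add: icoeff_even_def icoeff_odd_def choose_two_Suc zero_choose_two defs p_def)
    have e: "q powi (n - 2 * int k - 2 * int N + 1) = X * p * Z"
      using powi[of "2 * N + 1"] 2 by (simp add: defs mult_ac algebra_simps)
    have "(X - Xi) * d * Z = (X * p - Xi * q) * d * (p * Z) + X * p * Z"
      using rels by algebra
    then show ?thesis
      unfolding O qint_n qint_nk e using 2 by simp
  next
    case (3 i)
    define y yi B where "y = p ^ (2 * i)" "yi = q ^ (2 * i)" "B = p ^ (2 * i choose 2)"
    note defs' = this
    have y: "y * yi = 1" using rels(1) by (simp add: defs' mult.commute flip: power_mult_distrib)
    define C C' where "C = gauss N (Suc i)" "C' = gauss N i"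
    note defC = this
    have rel: "(1 - y ^ 2 * p ^ 4) * C = (1 - Z ^ 2 * y ^ 2 * p ^ 4) * C'"
      using gauss_ratio[of i N]
      by (simp add: defC defs defs' p_def power_add mult_ac flip: power_mult)
    have O: "icoeff_even N k = B * y ^ 2 * p * C" "icoeff_odd N k = B * y ^ 3 * p ^ 3 * C"
      "icoeff_odd N (k - 1) = B * y ^ 2 * p * Z * C'" "icoeff_odd N (k - 2) = B * y * C'"
      using 3 by (simp_all add: icoeff_even_def icoeff_odd_def choose_two_Suc power_add
          defs defs' defC power_numeral_reduce mult_ac flip: p_def)
        (simp_all add: mult.commute flip: power_add)
    have e: "q powi (n - 2 * int k - 2 * int N + 1) = X * p ^ 3 * y ^ 2 * Z"
      "q powi (n - 2 * int k - 2 * int N + 2) = X * p ^ 2 * y ^ 2 * Z"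
      using powi[of "4 * i + 2 * N + 3"] powi[of "4 * i + 2 * N + 2"] 3
      by (simp_all add: defs defs' power_add power2_eq_square[of p] algebra_simps flip: power_mult)
    have k: "q ^ k = yi * q ^ 2" "p ^ k = y * p ^ 2"
      using 3 by (simp_all add: defs' power_add power2_eq_square)
    have Nk: "2 * int N - 1 + int k = int (2 * N + 2 * i + 1)" using 3 by simp
    have qint_Nk: "qint (2 * int N - 1 + int k) = (Zi * yi * q - Z * y * p) * d"
      unfolding Nk qint_nat by (simp add: defs defs' power_add mult_ac)
    have "(X - Xi) * (y * p * C) =
        (X * (y * p ^ 2) - Xi * (yi * q ^ 2)) * (y ^ 2 * p ^ 3 * C) +
        X * p ^ 3 * y * Z * (y ^ 2 * p * Z * C') * (q - p) +
        X * p ^ 2 * y * Z * (Zi * yi * q - Z * y * p) * (y * C')"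
      using rels(1,3,4) y rel by algebra
    then have "(X - Xi) * d * (B * y ^ 2 * p * C) =
        (X * (y * p ^ 2) - Xi * (yi * q ^ 2)) * d * (B * y ^ 3 * p ^ 3 * C) +
        X * p ^ 3 * y ^ 2 * Z * (B * y ^ 2 * p * Z * C') +
        X * p ^ 2 * y ^ 2 * Z * ((Zi * yi * q - Z * y * p) * d) * (B * y * C')"
      using rels(2) by algebra
    then show ?thesis
      unfolding O qint_n qint_nk e k qint_Nk using 3 by simp
  next
    case (4 i)
    define y yi B where "y = p ^ (2 * i)" "yi = q ^ (2 * i)" "B = p ^ (2 * i choose 2)"
    note defs' = this
    have y: "y * yi = 1" using rels(1) by (simp add: defs' mult.commute flip: power_mult_distrib)
    define C C' where "C = gauss N (Suc i)" "C' = gauss N i"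
    note defC = this
    have rel: "(1 - y ^ 2 * p ^ 4) * C = (1 - Z ^ 2 * y ^ 2 * p ^ 4) * C'"
      using gauss_ratio[of i N]
      by (simp add: defC defs defs' p_def power_add mult_ac flip: power_mult)
    have O: "icoeff_even N k = B * y ^ 3 * p ^ 3 * Z * C" "icoeff_odd N k = B * y ^ 4 * p ^ 6 * Z * C"
      "icoeff_odd N (k - 1) = B * y ^ 3 * p ^ 3 * C" "icoeff_odd N (k - 2) = B * y ^ 2 * p * Z * C'"
      using 4 by (simp_all add: icoeff_even_def icoeff_odd_def choose_two_Suc power_add
          defs defs' defC power_numeral_reduce numeral_3_eq_3 mult_ac flip: p_def)
        (simp_all add: mult.commute flip: power_add)
    have e: "q powi (n - 2 * int k - 2 * int N + 1) = X * p ^ 5 * y ^ 2 * Z"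
      "q powi (n - 2 * int k - 2 * int N + 2) = X * p ^ 4 * y ^ 2 * Z"
      using powi[of "4 * i + 2 * N + 5"] powi[of "4 * i + 2 * N + 4"] 4
      by (simp_all add: defs defs' power_add algebra_simps flip: power_mult)
    have k: "q ^ k = yi * q ^ 3" "p ^ k = y * p ^ 3"
      using 4 by (simp_all add: defs' power_add power_numeral_reduce)
    have Nk: "2 * int N - 1 + int k = int (2 * N + 2 * i + 2)" using 4 by simp
    have qint_Nk: "qint (2 * int N - 1 + int k) = (Zi * yi * q ^ 2 - Z * y * p ^ 2) * d"
      unfolding Nk qint_nat by (simp add: defs defs' power_add mult_ac power2_eq_square)
    have "(X - Xi) * (y * p ^ 2 * C) =
        (X * (y * p ^ 3) - Xi * (yi * q ^ 3)) * (y ^ 2 * p ^ 5 * C) +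
        X * p ^ 5 * y * (y * p ^ 2 * y * C) * (q - p) +
        X * p ^ 4 * y * Z * (Zi * yi * q ^ 2 - Z * y * p ^ 2) * (y * C')"
      using rels(1,3,4) y rel by algebra
    then have "(X - Xi) * d * (B * y ^ 3 * p ^ 3 * Z * C) =
        (X * (y * p ^ 3) - Xi * (yi * q ^ 3)) * d * (B * y ^ 4 * p ^ 6 * Z * C) +
        X * p ^ 5 * y ^ 2 * Z * (B * y ^ 3 * p ^ 3 * C) +
        X * p ^ 4 * y ^ 2 * Z * ((Zi * yi * q ^ 2 - Z * y * p ^ 2) * d) * (B * y ^ 2 * p * Z * C')"
      using rels(2) by algebra
    then show ?thesis
      unfolding O qint_n qint_nk e k qint_Nk using 4 by simp
  qed
qed

text \<open>The recursion in the step to an odd \<open>n\<close>, where \<open>N\<close> drops by one and the vector \<open>t_odd (n - 2)\<close> is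
subtracted. The terms with \<open>q\<^sup>n\<close> and with \<open>q\<^sup>-\<^sup>n\<close> reduce to one Pascal rule each.\<close>
lemma icoeff_odd_step:
  fixes n :: int
  shows "qint n * icoeff_odd N k = qint (n - int k) * icoeff_even (Suc N) k +
    (if k \<ge> 1 then q powi (n - 2 * int k - 2 * int N) * icoeff_even (Suc N) (k - 1) else 0) +
    (if k \<ge> 2 then q powi (n - 2 * int k - 2 * int N + 1) * qint (2 * int N + int k) *
       icoeff_even (Suc N) (k - 2) - qint (n - 1) * icoeff_odd (Suc N) (k - 2) else 0)"
proof -
  define p where "p = inverse q"
  define d where "d = inverse (q - p)"
  define X Xi Z Zi where "X = q powi n" "Xi = q powi (- n)" "Z = p ^ (2 * N)" "Zi = q ^ (2 * N)"
  note defs = this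
  have rels: "q * p = 1" "d * (q - p) = 1" "X * Xi = 1" "Z * Zi = 1"
    using q_nonzero q_minus_inverse_nonzero
    by (simp_all add: p_def d_def defs power_int_minus power_inverse)
  have qint_nk: "qint (n - int k) = (X * p ^ k - Xi * q ^ k) * d" for k
    by (simp add: qint_diff_nat defs p_def d_def)
  have qint_n: "qint n = (X - Xi) * d"
    using qint_nk[of 0] by simp
  have qint_n1: "qint (n - 1) = (X * p - Xi * q) * d"
    using qint_nk[of 1] by simp
  have qint_nat: "qint (int k) = (q ^ k - p ^ k) * d" for k
    by (simp add: qint_of_nat d_def p_def)
  have powi: "q powi (n - int m) = X * p ^ m" for m
    by (simp add: q_powi_diff_nat defs p_def)
  consider "k = 0" | "k = 1" | i where "k = 2 * i + 2" | i where "k = 2 * i + 3"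
    by (rule nat_parity_cases)
  then show ?thesis
  proof cases
    case 1
    then show ?thesis by (simp add: icoeff_even_def icoeff_odd_def numeral_2_eq_2)
  next
    case 2
    have O: "icoeff_odd N k = p * Z" "icoeff_even (Suc N) (k - 1) = 1"
      "icoeff_even (Suc N) k = p ^ 2 * Z"
      using 2 by (simp_all add: icoeff_even_def icoeff_odd_def choose_two_Suc zero_choose_two
          defs p_def power2_eq_square)
    have e: "q powi (n - 2 * int k - 2 * int N) = X * p ^ 2 * Z"
      using powi[of "2 * N + 2"] 2 by (simp add: defs power_add power2_eq_square algebra_simps)
    have "(X - Xi) * d * (p * Z) = (X * p - Xi * q) * d * (p ^ 2 * Z) + X * p ^ 2 * Z"
      using rels by algebra
    then show ?thesis
      unfolding O qint_n qint_nk e using 2 by simp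
  next
    case (3 i)
    define y yi B where "y = p ^ (2 * i)" "yi = q ^ (2 * i)" "B = p ^ (2 * i choose 2)"
    note defs' = this
    have y: "y * yi = 1" using rels(1) by (simp add: defs' mult.commute flip: power_mult_distrib)
    define C D D' where "C = gauss N (Suc i)" "D = gauss (Suc N) (Suc i)" "D' = gauss (Suc N) i"
    note defC = this
    have rel: "D = C + Z ^ 2 * p ^ 4 * D'" "D = y ^ 2 * p ^ 4 * C + D'"
      using gauss_pascal[of N i] gauss.simps(3)[of N i] unfolding defC[symmetric]
      by (simp_all add: defs defs' p_def power_add mult_ac flip: power_mult)
    have O: "icoeff_odd N k = B * y ^ 3 * p ^ 3 * C" "icoeff_even (Suc N) k = B * y ^ 2 * p * D"
      "icoeff_even (Suc N) (k - 1) = B * y * p ^ 2 * Z * D'"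
      "icoeff_even (Suc N) (k - 2) = B * D'" "icoeff_odd (Suc N) (k - 2) = B * y * D'"
      using 3 by (simp_all add: icoeff_even_def icoeff_odd_def choose_two_Suc power_add
          defs defs' defC power_numeral_reduce mult_ac del: gauss.simps flip: p_def)
        (simp_all add: mult.commute flip: power_add)
    have e: "q powi (n - 2 * int k - 2 * int N) = X * p ^ 4 * y ^ 2 * Z"
      "q powi (n - 2 * int k - 2 * int N + 1) = X * p ^ 3 * y ^ 2 * Z"
      using powi[of "4 * i + 2 * N + 4"] powi[of "4 * i + 2 * N + 3"] 3
      by (simp_all add: defs defs' power_add algebra_simps flip: power_mult)
    have k: "q ^ k = yi * q ^ 2" "p ^ k = y * p ^ 2"
      using 3 by (simp_all add: defs' power_add power2_eq_square)
    have Nk: "2 * int N + int k = int (2 * N + 2 * i + 2)" using 3 by simp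
    have qint_Nk: "qint (2 * int N + int k) = (Zi * yi * q ^ 2 - Z * y * p ^ 2) * d"
      unfolding Nk qint_nat by (simp add: defs defs' power_add mult_ac power2_eq_square)
    have "(X - Xi) * (y ^ 2 * p ^ 3 * C) =
        (X * (y * p ^ 2) - Xi * (yi * q ^ 2)) * (y * p * D) +
        X * p ^ 4 * y * Z * (y * p ^ 2 * Z * D') * (q - p) +
        X * p ^ 3 * y * Z * (Zi * yi * q ^ 2 - Z * y * p ^ 2) * D' - (X * p - Xi * q) * D'"
      using rels(1,3,4) y rel by algebra
    then have "(X - Xi) * d * (B * y ^ 3 * p ^ 3 * C) =
        (X * (y * p ^ 2) - Xi * (yi * q ^ 2)) * d * (B * y ^ 2 * p * D) +
        X * p ^ 4 * y ^ 2 * Z * (B * y * p ^ 2 * Z * D') +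
        (X * p ^ 3 * y ^ 2 * Z * ((Zi * yi * q ^ 2 - Z * y * p ^ 2) * d) * (B * D') -
         (X * p - Xi * q) * d * (B * y * D'))"
      using rels(2) by algebra
    then show ?thesis
      unfolding O qint_n qint_n1 qint_nk e k qint_Nk using 3 by simp
  next
    case (4 i)
    define y yi B where "y = p ^ (2 * i)" "yi = q ^ (2 * i)" "B = p ^ (2 * i choose 2)"
    note defs' = this
    have y: "y * yi = 1" using rels(1) by (simp add: defs' mult.commute flip: power_mult_distrib)
    define C D D' where "C = gauss N (Suc i)" "D = gauss (Suc N) (Suc i)" "D' = gauss (Suc N) i"
    note defC = this
    have rel: "D = C + Z ^ 2 * p ^ 4 * D'" "D = y ^ 2 * p ^ 4 * C + D'"
      using gauss_pascal[of N i] gauss.simps(3)[of N i] unfolding defC[symmetric]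
      by (simp_all add: defs defs' p_def power_add mult_ac flip: power_mult)
    have O: "icoeff_odd N k = B * y ^ 4 * p ^ 6 * Z * C"
      "icoeff_even (Suc N) k = B * y ^ 3 * p ^ 5 * Z * D"
      "icoeff_even (Suc N) (k - 1) = B * y ^ 2 * p * D"
      "icoeff_even (Suc N) (k - 2) = B * y * p ^ 2 * Z * D'"
      "icoeff_odd (Suc N) (k - 2) = B * y ^ 2 * p ^ 3 * Z * D'"
      using 4 by (simp_all add: icoeff_even_def icoeff_odd_def choose_two_Suc power_add
          defs defs' defC power_numeral_reduce numeral_3_eq_3 mult_ac del: gauss.simps flip: p_def)
        (simp_all add: mult.commute flip: power_add)
    have e: "q powi (n - 2 * int k - 2 * int N) = X * p ^ 6 * y ^ 2 * Z"
      "q powi (n - 2 * int k - 2 * int N + 1) = X * p ^ 5 * y ^ 2 * Z"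
      using powi[of "4 * i + 2 * N + 6"] powi[of "4 * i + 2 * N + 5"] 4
      by (simp_all add: defs defs' power_add algebra_simps flip: power_mult)
    have k: "q ^ k = yi * q ^ 3" "p ^ k = y * p ^ 3"
      using 4 by (simp_all add: defs' power_add power_numeral_reduce)
    have Nk: "2 * int N + int k = int (2 * N + 2 * i + 3)" using 4 by simp
    have qint_Nk: "qint (2 * int N + int k) = (Zi * yi * q ^ 3 - Z * y * p ^ 3) * d"
      unfolding Nk qint_nat by (simp add: defs defs' power_add mult_ac power_numeral_reduce)
    have "(X - Xi) * (y ^ 2 * p ^ 5 * C) =
        (X * (y * p ^ 3) - Xi * (yi * q ^ 3)) * (y * p ^ 4 * D) +
        X * p ^ 6 * y * y * D * (q - p) +
        X * p ^ 5 * y * Z * (Zi * yi * q ^ 3 - Z * y * p ^ 3) * p * D' - (X * p - Xi * q) * p ^ 2 * D'"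
      using rels(1,3,4) y rel by algebra
    then have "(X - Xi) * d * (B * y ^ 4 * p ^ 6 * Z * C) =
        (X * (y * p ^ 3) - Xi * (yi * q ^ 3)) * d * (B * y ^ 3 * p ^ 5 * Z * D) +
        X * p ^ 6 * y ^ 2 * Z * (B * y ^ 2 * p * D) +
        (X * p ^ 5 * y ^ 2 * Z * ((Zi * yi * q ^ 3 - Z * y * p ^ 3) * d) * (B * y * p ^ 2 * Z * D') -
         (X * p - Xi * q) * d * (B * y ^ 2 * p ^ 3 * Z * D'))"
      using rels(2) by algebra
    then show ?thesis
      unfolding O qint_n qint_n1 qint_nk e k qint_Nk using 4 by simp
  qed
qed

text \<open>Both parities in terms of the coordinate \<open>r = n + 1 - k\<close>, in the shape produced by \<open>t_sum_Fdiv\<close>.\<close>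
lemma icoeff_step:
  assumes "n \<le> 2 * l + 1" "r \<le> Suc n"
  shows "qint (int n + 1) * icoeff l (Suc n) r =
    q powi (2 * int r - int (2 * l + 1) + 1) * qint (int (2 * l + 1) - int r) * icoeff l n (Suc r) +
    q powi (2 * int r - int (2 * l + 1)) * icoeff l n r + qint (int r) * icoeff l n (r - 1) -
    (if even n then qint (int n) * icoeff l (n - 1) r else 0)"
proof -
  define k where "k = Suc n - r"
  have r: "int r = int n + 1 - int k" "n - r = k - 1" "n - Suc r = k - 2" "n - 1 - r = k - 2"
    using assms(2) by (auto simp: k_def)
  have top: "qint (int r) * icoeff l n (r - 1) = qint (int r) *
      (if even n then icoeff_even (l + 1 - n div 2) k else icoeff_odd (l - n div 2) k)"
  proof (cases r)
    case (Suc s)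
    then have "n - s = k" using assms(2) by (simp add: k_def)
    then show ?thesis using Suc assms(2) by (simp add: icoeff_def)
  qed simp
  show ?thesis
  proof (cases "even n")
    case True
    then obtain a where a: "n = 2 * a" by blast
    define N where "N = l - a"
    have N: "int l = int N + int a" "l + 1 - a = Suc N" using assms(1) a by (auto simp: N_def)
    have low: "qint (int n) * icoeff l (n - 1) r =
        (if k \<ge> 2 then qint (int n) * icoeff_odd (Suc N) (k - 2) else 0)"
    proof (cases a)
      case (Suc b)
      then have "n - 1 = 2 * b + 1" "l - b = Suc N" using a N(2) by auto
      then show ?thesis using r(4) Suc a by (auto simp: icoeff_def k_def)
    qed (use a in simp)
    have e: "2 * int r - int (2 * l + 1) = (int n + 1) - 2 * int k - 2 * int N"
      "int (2 * l + 1) - int r = 2 * int N + int k"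
      using r(1) a N(1) by auto
    have c: "icoeff l (Suc n) r = icoeff_odd N k"
      "icoeff l n r = (if k \<ge> 1 then icoeff_even (Suc N) (k - 1) else 0)"
      "icoeff l n (Suc r) = (if k \<ge> 2 then icoeff_even (Suc N) (k - 2) else 0)"
      "l + 1 - n div 2 = Suc N"
      using a N(2) r(2,3) assms(2) by (auto simp: icoeff_def k_def N_def)
    show ?thesis
      unfolding top e low c using icoeff_odd_step[of "int n + 1" N k] True
      by (cases "k \<ge> 2"; cases "k \<ge> 1") (simp_all add: r(1) mult_ac)
  next
    case False
    then obtain a where a: "n = 2 * a + 1" by (rule oddE)
    define N where "N = l - a"
    have N: "int l = int N + int a" using assms(1) a by (auto simp: N_def)
    have e: "2 * int r - int (2 * l + 1) = (int n + 1) - 2 * int k - 2 * int N + 1"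
      "int (2 * l + 1) - int r = 2 * int N - 1 + int k"
      using r(1) a N by auto
    have c: "icoeff l (Suc n) r = icoeff_even N k"
      "icoeff l n r = (if k \<ge> 1 then icoeff_odd N (k - 1) else 0)"
      "icoeff l n (Suc r) = (if k \<ge> 2 then icoeff_odd N (k - 2) else 0)"
      "l - n div 2 = N"
      using a r(2,3) assms(2) by (auto simp: icoeff_def k_def N_def)
    show ?thesis
      unfolding top e c using icoeff_even_step[of "int n + 1" N k] False
      by (cases "k \<ge> 2"; cases "k \<ge> 1") (simp_all add: r(1) mult_ac)
  qed
qed

lemma icoeff_diagonal: "icoeff l n n = 1"
  by (simp add: icoeff_def icoeff_even_def icoeff_odd_def choose_two_Suc zero_choose_two)

text \<open>The exponent of \<open>q\<^sup>-\<^sup>1\<close> is positive. The only critical case is \<open>k = 1\<close> with even \<open>n\<close>, where the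
binomial part vanishes; then \<open>n \<le> 2l\<close>, so that \<open>2N > 0\<close>.\<close>
lemma icoeff_in_qinv_int_polys:
  assumes "n \<le> 2 * l + 1" "r < n"
  shows "icoeff l n r \<in> qinv_int_polys"
proof -
  define k where "k = n - r"
  have "k > 0" using assms(2) by (simp add: k_def)
  then have pos: "k choose 2 > 0 \<or> k = 1"
    using zero_less_binomial_iff[of k 2] by force
  show ?thesis
  proof (cases "even n")
    case True
    then have "l + 1 - n div 2 > 0" using assms(1) by (auto elim!: evenE)
    then have "(k choose 2) + (if odd k then 2 * (l + 1 - n div 2) else 0) > 0"
      using pos by auto
    then have "icoeff_even (l + 1 - n div 2) k \<in> qinv_int_polys"
      unfolding icoeff_even_def by (intro qinv_int_polys_power_mult gauss_in_int_polys_inv_q)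
    then show ?thesis using True assms(2) by (simp add: icoeff_def k_def)
  next
    case False
    have "(Suc k choose 2) + (if odd k then 2 * (l - n div 2) else 0) > 0"
      using \<open>k > 0\<close> by (simp add: choose_two_Suc)
    then have "icoeff_odd (l - n div 2) k \<in> qinv_int_polys"
      unfolding icoeff_odd_def by (intro qinv_int_polys_power_mult gauss_in_int_polys_inv_q)
    then show ?thesis using False assms(2) by (simp add: icoeff_def k_def)
  qed
qed

text \<open>Both expansions have \<open>N = 0\<close>, and the shift of \<open>k\<close> by one cancels the shift in the exponent.\<close>
lemma icoeff_Suc_weight:
  assumes "r \<le> 2 * l + 1"
  shows "icoeff l (2 * l + 2) r = icoeff l (2 * l + 1) r"
  using assms by (simp add: icoeff_def icoeff_even_def icoeff_odd_def Suc_diff_le)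

locale odd_highest_weight_module = simple_highest_weight_module \<mu> V act v
  for \<mu> :: nat and V :: "'v::ab_group_add set" and act v +
  fixes l :: nat
  assumes weight: "\<mu> = 2 * l + 1"
begin

lemma act_t_step:
  assumes "n \<le> \<mu>"
    "act (t_odd n) v = act (\<Sum>r\<le>n. scaleU (icoeff l n r) (Fdiv r)) v"
    "even n \<Longrightarrow> n > 0 \<Longrightarrow>
       act (t_odd (n - 1)) v = act (\<Sum>r\<le>n - 1. scaleU (icoeff l (n - 1) r) (Fdiv r)) v"
  shows "act (t * t_odd n - (if even n then scaleU (qint (int n)) (t_odd (n - 1)) else 0)) v =
    act (scaleU (qint (int n + 1)) (\<Sum>r\<le>Suc n. scaleU (icoeff l (Suc n) r) (Fdiv r))) v"
proof -
  let ?T = "\<lambda>n. \<Sum>r\<le>n. scaleU (icoeff l n r) (Fdiv r)"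
  let ?g = "\<lambda>r. q powi (2 * int r - int \<mu> + 1) * qint (int \<mu> - int r) * icoeff l n (Suc r) +
      q powi (2 * int r - int \<mu>) * icoeff l n r + qint (int r) * icoeff l n (r - 1)"
  let ?h = "\<lambda>r. if even n then qint (int n) * icoeff l (n - 1) r else 0"
  have 1: "act (t * t_odd n) v = act (\<Sum>r\<le>Suc n. scaleU (?g r) (Fdiv r)) v"
    using act_cong_mult[OF assms(2), of t] t_sum_Fdiv[of n "icoeff l n"]
    by (simp add: icoeff_def)
  have ext: "?T (n - 1) = (\<Sum>r\<le>Suc n. scaleU (icoeff l (n - 1) r) (Fdiv r))"
    by (rule sum.mono_neutral_left) (auto simp: icoeff_def)
  have 2: "act (if even n then scaleU (qint (int n)) (t_odd (n - 1)) else 0) v =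
      act (\<Sum>r\<le>Suc n. scaleU (?h r) (Fdiv r)) v"
  proof (cases "even n \<and> n > 0")
    case True
    then have "act (scaleU (qint (int n)) (t_odd (n - 1))) v = act (scaleU (qint (int n)) (?T (n - 1))) v"
      by (intro act_cong_scale assms(3)) auto
    then show ?thesis using True unfolding ext by (simp add: Uq.scale_sum_right del: sum.atMost_Suc)
  qed auto
  have "act (t * t_odd n - (if even n then scaleU (qint (int n)) (t_odd (n - 1)) else 0)) v =
      act ((\<Sum>r\<le>Suc n. scaleU (?g r) (Fdiv r)) - (\<Sum>r\<le>Suc n. scaleU (?h r) (Fdiv r))) v"
    by (simp only: act_diff 1 2)
  also have "(\<Sum>r\<le>Suc n. scaleU (?g r) (Fdiv r)) - (\<Sum>r\<le>Suc n. scaleU (?h r) (Fdiv r)) =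
      (\<Sum>r\<le>Suc n. scaleU (?g r - ?h r) (Fdiv r))"
    by (simp add: Uq.scale_left_diff_distrib sum_subtractf del: sum.atMost_Suc)
  also have "\<dots> = (\<Sum>r\<le>Suc n. scaleU (qint (int n + 1) * icoeff l (Suc n) r) (Fdiv r))"
    using assms(1) unfolding weight by (intro sum.cong arg_cong2[where f = scaleU] icoeff_step[symmetric]) auto
  also have "\<dots> = scaleU (qint (int n + 1)) (?T (Suc n))"
    by (simp add: Uq.scale_sum_right del: sum.atMost_Suc)
  finally show ?thesis .
qed

lemma act_t_odd:
  "n \<le> Suc \<mu> \<Longrightarrow> act (t_odd n) v = act (\<Sum>r\<le>n. scaleU (icoeff l n r) (Fdiv r)) v"
proof (induction n rule: t_odd.induct)
  case 1
  then show ?case by (simp add: Fdiv_0 icoeff_diagonal)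
next
  case 2
  have 0: "act (t_odd 0) v = act (\<Sum>r\<le>0. scaleU (icoeff l 0 r) (Fdiv r)) v"
    by (simp add: Fdiv_0 icoeff_diagonal)
  have "qint 1 = 1" using q_minus_inverse_nonzero by (simp add: qint_def)
  then show ?case using act_t_step[OF _ 0] by simp
next
  case (3 n)
  define c where "c = qint (int n + 2)"
  have "c \<noteq> 0" by (simp add: c_def qint_eq_0_iff)
  define S where "S = (\<Sum>r\<le>Suc (Suc n). scaleU (icoeff l (Suc (Suc n)) r) (Fdiv r))"
  have "act (t_odd (Suc n)) v = act (\<Sum>r\<le>Suc n. scaleU (icoeff l (Suc n) r) (Fdiv r)) v"
    using 3 by (cases "even n") auto
  then have "act (t * t_odd (Suc n) - (if even (Suc n) then scaleU (qint (int (Suc n))) (t_odd (Suc n - 1)) else 0)) v =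
    act (scaleU (qint (int (Suc n) + 1)) S) v"
    unfolding S_def using 3 by (intro act_t_step) auto
  then have "act (scaleU c (t_odd (Suc (Suc n)))) v = act (scaleU c S) v"
    using \<open>c \<noteq> 0\<close> by (simp add: add.commute flip: c_def split: if_splits)
  then have "act (scaleU (inverse c) (scaleU c (t_odd (Suc (Suc n))))) v = act (scaleU (inverse c) (scaleU c S)) v"
    by (rule act_cong_scale)
  then show ?case using \<open>c \<noteq> 0\<close> by (simp add: S_def del: t_odd.simps sum.atMost_Suc)
qed

lemma act_t_odd_Suc_top: "act (t_odd (Suc \<mu>)) v = act (t_odd \<mu>) v"
proof -
  have "act (t_odd (Suc \<mu>)) v = act (\<Sum>r\<le>\<mu>. scaleU (icoeff l (Suc \<mu>) r) (Fdiv r)) v"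
    using act_t_odd[of "Suc \<mu>"] Fdiv_Suc_weight_eq_0 by (simp add: act_add_left[OF hwv_closed] act_scale_eq_0_iff)
  also have "\<dots> = act (\<Sum>r\<le>\<mu>. scaleU (icoeff l \<mu> r) (Fdiv r)) v"
    using icoeff_Suc_weight[of _ l] by (intro act_cong_sum) (simp add: weight)
  also have "\<dots> = act (t_odd \<mu>) v" by (simp add: act_t_odd)
  finally show ?thesis .
qed

text \<open>At \<open>n = \<mu> + 2\<close> the two terms of the recursion cancel by \<open>act_t_odd_Suc_top\<close>. Afterwards the vector
\<open>t_odd (\<mu> + 1) v\<close>, which is nonzero, enters no further step, as \<open>\<mu> + 1\<close> is even.\<close>
lemma act_t_odd_eq_0: "n \<ge> \<mu> + 2 \<Longrightarrow> act (t_odd n) v = 0"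
proof (induction n rule: t_odd.induct)
  case (3 n)
  have "act (t * t_odd (Suc n) - (if even n then 0 else scaleU (qint (int n + 1)) (t_odd n))) v = 0"
  proof (cases "n = \<mu>")
    case True
    have "odd \<mu>" by (simp add: weight)
    then obtain m where m: "\<mu> = Suc m" by (cases \<mu>) auto
    have "act (t * t_odd (Suc \<mu>)) v = act (t * t_odd \<mu>) v"
      by (rule act_cong_mult) (rule act_t_odd_Suc_top)
    also have "t * t_odd \<mu> = scaleU (qint (int \<mu> + 1)) (t_odd (Suc \<mu>))"
      using t_odd_even[of "l + 1"] by (simp add: weight algebra_simps)
    also have "act \<dots> v = act (scaleU (qint (int \<mu> + 1)) (t_odd \<mu>)) v"
      by (rule act_cong_scale) (rule act_t_odd_Suc_top)
    finally show ?thesis using \<open>odd \<mu>\<close> True by (simp add: act_diff)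
  next
    case False
    have "act (t_odd (Suc n)) v = 0"
      using 3 False by (cases "even n") auto
    then have "act (t * t_odd (Suc n)) v = 0"
      using act_cong_mult[of "t_odd (Suc n)" 0 t] by (simp add: act_0)
    moreover have "act (scaleU (qint (int n + 1)) (t_odd n)) v = 0" if "odd n"
    proof -
      have "n \<noteq> Suc \<mu>" using that weight by auto
      then show ?thesis using 3 False that by (simp add: act_scale_eq_0_iff)
    qed
    ultimately show ?thesis by (simp add: act_diff act_0)
  qed
  then show ?case by (simp add: act_scale_eq_0_iff split: if_splits)
qed (simp_all add: weight)

end

section \<open>The \<open>\<iota>\<close>-canonical basis of the module\<close>

lemma bar_eq_0_iff: "bar x = 0 \<longleftrightarrow> x = 0"
proof
  assume "bar x = 0"
  show "x = 0"
  proof (rule ccontr)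
    assume "x \<noteq> 0"
    then have "bar x * bar (inverse x) = 1" by (simp add: bar_1 flip: bar_mult)
    then show False using \<open>bar x = 0\<close> by simp
  qed
qed (simp add: bar_0)

lemma bar_diff: "bar (x - y) = bar x - bar y"
  using bar_add[of "x - y" y] by simp

lemma (in Uq_module) act_UScal_UScal:
  "x \<in> V \<Longrightarrow> act (UScal a) (act (UScal b) x) = act (UScal (a * b)) x"
  by (simp add: UScal_mult act_mult)

text \<open>Compatibility with rational constants and with \<open>q\<close> determines compatibility with all scalars:
first for polynomials in \<open>q\<close>, then for quotients by clearing the denominator.\<close>
lemma (in Uq_module) bar_involution_semilinear:
  assumes "is_bar_involution V act v \<psi>" "x \<in> V"
  shows "\<psi> (act (UScal c) x) = act (UScal (bar c)) (\<psi> x)"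
proof -
  have closed: "\<psi> y \<in> V" if "y \<in> V" for y
    using assms(1) that by (auto simp: is_bar_involution_def)
  have add: "\<psi> (y + z) = \<psi> y + \<psi> z" if "y \<in> V" "z \<in> V" for y z
    using assms(1) that by (auto simp: is_bar_involution_def)
  have rat: "\<psi> (act (UScal (rat_const a)) y) = act (UScal (rat_const a)) (\<psi> y)" if "y \<in> V" for a y
    using assms(1) that by (auto simp: is_bar_involution_def)
  have q: "\<psi> (act (UScal q) y) = act (UScal (inverse q)) (\<psi> y)" if "y \<in> V" for y
    using assms(1) that by (auto simp: is_bar_involution_def)
  have poly: "\<psi> (act (UScal (eval_at f q)) y) = act (UScal (bar (eval_at f q))) (\<psi> y)"
    if y: "y \<in> V" for f y
  proof (induction f)
    case 0
    then show ?case using rat[OF y, of 0] by (simp add: eval_at_simps bar_0)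
  next
    case (pCons a f)
    have e: "eval_at (pCons a f) q = rat_const a + q * eval_at f q"
      by (simp add: eval_at_def map_poly_pCons)
    have "\<psi> (act (UScal (q * eval_at f q)) y) = act (UScal (inverse q * bar (eval_at f q))) (\<psi> y)"
      using pCons(2) q[of "act (UScal (eval_at f q)) y"] y
      by (simp add: act_closed closed act_UScal_UScal[symmetric])
    then show ?case
      using y by (simp add: e UScal_add act_add_left act_closed closed add rat bar_add bar_mult
          bar_q bar_rat_const)
  qed
  obtain f g where g: "g \<noteq> 0" and c: "c = eval_at f q / eval_at g q"
    by (rule ratfun_quotient_cases)
  define b where "b = eval_at g q"
  have b: "b \<noteq> 0" using g by (simp add: b_def eval_at_q_eq_0_iff)
  have cb: "b * c = eval_at f q" using b by (simp add: c b_def)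
  have "act (UScal (bar b)) (\<psi> (act (UScal c) x)) = \<psi> (act (UScal b) (act (UScal c) x))"
    using poly[of "act (UScal c) x" g] assms(2) by (simp add: b_def act_closed)
  also have "\<dots> = act (UScal (bar b * bar c)) (\<psi> x)"
    using poly[OF assms(2), of f] assms(2) by (simp add: act_UScal_UScal cb flip: bar_mult)
  finally have "act (UScal (inverse (bar b))) (act (UScal (bar b)) (\<psi> (act (UScal c) x))) =
      act (UScal (inverse (bar b))) (act (UScal (bar b * bar c)) (\<psi> x))"
    by simp
  then show ?thesis
    using b assms(2) by (simp add: act_UScal_UScal closed act_closed bar_eq_0_iff UScal_1 act_one
        flip: mult.assoc)
qed

context odd_highest_weight_module
begin

text \<open>Bar involution and expansions are handled through coordinates with respect to the vectors
\<open>t_odd n v\<close>, because the involution conjugates these coordinates one by one.\<close>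
definition tvec :: "nat \<Rightarrow> (nat \<Rightarrow> ratfun) \<Rightarrow> 'v" where
  "tvec m d = act (\<Sum>n\<le>m. scaleU (d n) (t_odd n)) v"

lemma tvec_cong: "(\<And>n. n \<le> m \<Longrightarrow> d n = e n) \<Longrightarrow> tvec m d = tvec m e"
  by (simp add: tvec_def)

lemma tvec_eq_sum: "tvec m d = (\<Sum>n\<le>m. act (UScal (d n)) (act (t_odd n) v))"
  by (simp add: tvec_def act_sum scaleU_def act_mult[OF hwv_closed])

lemma tvec_closed: "tvec m d \<in> V"
  by (simp add: tvec_def act_closed')

lemma tvec_add: "tvec m (\<lambda>n. d n + e n) = tvec m d + tvec m e"
  by (simp add: tvec_def Uq.scale_left_distrib sum.distrib act_add_left[OF hwv_closed])

lemma tvec_diff: "tvec m (\<lambda>n. d n - e n) = tvec m d - tvec m e"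
  by (simp add: tvec_def Uq.scale_left_diff_distrib sum_subtractf act_diff)

lemma tvec_scale: "act (UScal c) (tvec m d) = tvec m (\<lambda>n. c * d n)"
  by (simp add: tvec_def Uq.scale_sum_right flip: act_mult[OF hwv_closed] scaleU_def)

lemma tvec_delta: "n \<le> m \<Longrightarrow> tvec m (\<lambda>i. if i = n then 1 else 0) = act (t_odd n) v"
  by (simp add: tvec_def if_distrib[of "\<lambda>c. scaleU c _"] sum.delta cong: if_cong)

text \<open>The matrix of the \<open>\<iota>\<close>-divided powers is unitriangular, so the leading coordinates agree.\<close>
lemma tvec_triangular:
  assumes "m \<le> \<mu>"
  obtains c where "c m = d m" "tvec m d = act (\<Sum>r\<le>m. scaleU (c r) (Fdiv r)) v"
proof -
  let ?c = "\<lambda>r. \<Sum>n\<le>m. d n * icoeff l n r"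
  have "?c m = (\<Sum>n\<in>{m}. d n * icoeff l n m)"
    by (rule sum.mono_neutral_right) (auto simp: icoeff_def)
  then have top: "?c m = d m" by (simp add: icoeff_diagonal)
  have "tvec m d = act (\<Sum>n\<le>m. scaleU (d n) (\<Sum>r\<le>m. scaleU (icoeff l n r) (Fdiv r))) v"
    unfolding tvec_def
  proof (intro act_cong_sum act_cong_scale)
    fix n assume n: "n \<in> {..m}"
    have "act (t_odd n) v = act (\<Sum>r\<le>n. scaleU (icoeff l n r) (Fdiv r)) v"
      using assms n by (intro act_t_odd) simp
    also have "(\<Sum>r\<le>n. scaleU (icoeff l n r) (Fdiv r)) = (\<Sum>r\<le>m. scaleU (icoeff l n r) (Fdiv r))"
      using n by (intro sum.mono_neutral_left) (auto simp: icoeff_def)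
    finally show "act (t_odd n) v = act (\<Sum>r\<le>m. scaleU (icoeff l n r) (Fdiv r)) v" .
  qed
  also have "(\<Sum>n\<le>m. scaleU (d n) (\<Sum>r\<le>m. scaleU (icoeff l n r) (Fdiv r))) =
      (\<Sum>r\<le>m. scaleU (?c r) (Fdiv r))"
    by (simp add: Uq.scale_sum_right Uq.scale_sum_left) (rule sum.swap)
  finally have "tvec m d = act (\<Sum>r\<le>m. scaleU (?c r) (Fdiv r)) v" .
  with top show ?thesis by (rule that)
qed

lemma tvec_Suc_eq_0: "d (Suc m) = 0 \<Longrightarrow> tvec (Suc m) d = tvec m d"
  by (simp add: tvec_def)

text \<open>The uniqueness principle behind canonical bases. The leading coordinate in the basis \<open>t_odd n v\<close> is
bar-invariant by assumption and, being also the leading coordinate in the \<open>F\<^sup>(\<^sup>r\<^sup>) v\<close>, lies in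
\<open>q\<^sup>-\<^sup>1 \<int>[q\<^sup>-\<^sup>1]\<close>. Hence it is zero, and the next one becomes the leading coordinate.\<close>
lemma lattice_bar_invariant_eq_0:
  assumes "m \<le> \<mu>" "tvec m e = act (\<Sum>r\<le>\<mu>. scaleU (f r - g r) (Fdiv r)) v"
    "\<And>r. r \<le> \<mu> \<Longrightarrow> f r \<in> qinv_int_polys" "\<And>r. r \<le> \<mu> \<Longrightarrow> g r \<in> qinv_int_polys"
    "\<And>n. n \<le> m \<Longrightarrow> bar (e n) = e n" "n \<le> m"
  shows "e n = 0"
  using assms(1,2,5,6)
proof (induction m arbitrary: n)
  have top: "e m = 0" if m: "m \<le> \<mu>" and eq: "tvec m e = act (\<Sum>r\<le>\<mu>. scaleU (f r - g r) (Fdiv r)) v"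
    and inv: "bar (e m) = e m" for m
  proof -
    obtain c where c: "c m = e m" "tvec m e = act (\<Sum>r\<le>m. scaleU (c r) (Fdiv r)) v"
      using m by (rule tvec_triangular)
    define c' where "c' r = (if r \<le> m then c r else 0)" for r
    have "(\<Sum>r\<le>m. scaleU (c r) (Fdiv r)) = (\<Sum>r\<le>\<mu>. scaleU (c' r) (Fdiv r))"
      using m by (intro sum.mono_neutral_cong_left) (auto simp: c'_def)
    then have "act ((\<Sum>r\<le>\<mu>. scaleU (c' r) (Fdiv r)) - (\<Sum>r\<le>\<mu>. scaleU (f r - g r) (Fdiv r))) v = 0"
      using c(2) eq by (simp add: act_diff)
    then have "act (\<Sum>r\<le>\<mu>. scaleU (c' r - (f r - g r)) (Fdiv r)) v = 0"
      by (simp only: Uq.scale_left_diff_distrib sum_subtractf)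
    then have "c' m - (f m - g m) = 0" by (rule Fdiv_independent[OF order_refl]) (rule m)
    then have em: "e m = f m - g m" using c(1) by (simp add: c'_def)
    then have "f m = g m" using bar_invariant_diff_eq_0 assms(3,4) m inv by metis
    then show ?thesis using em by simp
  qed
  {
    case 0
    then show ?case using top by simp
  next
    case (Suc m)
    have "e (Suc m) = 0" using Suc.prems by (intro top) auto
    then show ?case using Suc tvec_Suc_eq_0[of e m] by (cases "n = Suc m") auto
  }
qed

lemma tvec_eq_0D:
  assumes "m \<le> \<mu>" "tvec m d = 0" "n \<le> m"
  shows "d n = 0"
  using assms
proof (induction m arbitrary: n)
  have top: "d m = 0" if m: "m \<le> \<mu>" and eq: "tvec m d = 0" for m
  proof -
    obtain c where "c m = d m" "tvec m d = act (\<Sum>r\<le>m. scaleU (c r) (Fdiv r)) v"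
      using m by (rule tvec_triangular)
    then show ?thesis using Fdiv_independent[OF m, of c m] eq by simp
  qed
  {
    case 0
    then show ?case using top by simp
  next
    case (Suc m)
    have "d (Suc m) = 0" using Suc.prems by (intro top) auto
    then show ?case using Suc tvec_Suc_eq_0[of d m] by (cases "n = Suc m") auto
  }
qed

lemma tvec_inject:
  assumes "tvec \<mu> d = tvec \<mu> e" "n \<le> \<mu>"
  shows "d n = e n"
  using tvec_eq_0D[of \<mu> "\<lambda>n. d n - e n" n] assms by (simp add: tvec_diff)

lemma tvec_surj:
  assumes "x \<in> V"
  obtains d where "x = tvec \<mu> d"
proof -
  have "\<exists>d. act (\<Sum>r\<le>m. scaleU (c r) (Fdiv r)) v = tvec m d" if "m \<le> \<mu>" for m c
    using that
  proof (induction m arbitrary: c)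
    case 0
    show ?case by (rule exI[of _ c]) (simp add: tvec_def Fdiv_0)
  next
    case (Suc m)
    define k where "k = c (Suc m)"
    obtain d where d: "act (\<Sum>r\<le>m. scaleU (c r - k * icoeff l (Suc m) r) (Fdiv r)) v = tvec m d"
      using Suc by fastforce
    have T: "act (scaleU k (t_odd (Suc m))) v =
        act (scaleU k (\<Sum>r\<le>Suc m. scaleU (icoeff l (Suc m) r) (Fdiv r))) v"
      using Suc.prems by (intro act_cong_scale act_t_odd) simp
    have "tvec (Suc m) (d(Suc m := k)) = tvec m d + act (scaleU k (t_odd (Suc m))) v"
      by (simp add: tvec_def act_add_left[OF hwv_closed])
    also have "\<dots> = act ((\<Sum>r\<le>m. scaleU (c r - k * icoeff l (Suc m) r) (Fdiv r)) +
        scaleU k (\<Sum>r\<le>Suc m. scaleU (icoeff l (Suc m) r) (Fdiv r))) v"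
      by (simp only: act_add_left[OF hwv_closed] d T)
    also have "(\<Sum>r\<le>m. scaleU (c r - k * icoeff l (Suc m) r) (Fdiv r)) +
        scaleU k (\<Sum>r\<le>Suc m. scaleU (icoeff l (Suc m) r) (Fdiv r)) =
        (\<Sum>r\<le>Suc m. scaleU (c r) (Fdiv r))"
      by (simp add: icoeff_diagonal k_def Uq.scale_sum_right Uq.scale_right_distrib
        Uq.scale_left_diff_distrib sum_subtractf)
    finally show ?case by metis
  qed
  then show ?thesis using Fdiv_spanning[OF assms] that by (metis order_refl)
qed

lemma bar_involution_tvec:
  assumes "is_bar_involution V act v \<psi>"
  shows "\<psi> (tvec m d) = tvec m (\<lambda>n. bar (d n))"
proof -
  have zero: "\<psi> 0 = 0"
    using assms zero_closed add_0 unfolding is_bar_involution_def by (metis add_cancel_right_right)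
  have "\<psi> (\<Sum>i\<in>A. act (UScal (d i)) (act (t_odd i) v)) =
      (\<Sum>i\<in>A. act (UScal (bar (d i))) (act (t_odd i) v)) \<and>
      (\<Sum>i\<in>A. act (UScal (d i)) (act (t_odd i) v)) \<in> V" if "finite A" for A
    using that
  proof induction
    case (insert i A)
    then show ?case
      using assms bar_involution_semilinear[OF assms act_closed', of "d i" "t_odd i"]
      by (auto simp: is_bar_involution_def act_closed act_closed' add_closed)
  qed (simp add: zero zero_closed)
  then show ?thesis by (simp add: tvec_eq_sum)
qed

text \<open>Conjugating coordinates fixes the basis vectors by construction. That it also fixes \<open>t_odd n v\<close> for
\<open>n > \<mu>\<close> is where the behaviour of these vectors beyond the weight enters.\<close>
lemma bar_involution_exists: "\<exists>\<psi>. is_bar_involution V act v \<psi>"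
proof -
  define co where "co x = (SOME d. x = tvec \<mu> d)" for x
  define \<psi> where "\<psi> = (\<lambda>x\<in>V. tvec \<mu> (\<lambda>n. bar (co x n)))"
  have \<psi>: "\<psi> (tvec \<mu> d) = tvec \<mu> (\<lambda>n. bar (d n))" for d
  proof -
    have "tvec \<mu> d = tvec \<mu> (co (tvec \<mu> d))"
      unfolding co_def by (rule someI[of "\<lambda>e. tvec \<mu> d = tvec \<mu> e"]) simp
    then have "co (tvec \<mu> d) n = d n" if "n \<le> \<mu>" for n
      using tvec_inject that by metis
    then show ?thesis by (auto simp: \<psi>_def tvec_closed intro: tvec_cong)
  qed
  have fix_le: "\<psi> (act (t_odd n) v) = act (t_odd n) v" if "n \<le> \<mu>" for n
    using \<psi>[of "\<lambda>i. if i = n then 1 else 0"] tvec_delta[OF that]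
    by (simp add: if_distrib[of bar] bar_0 bar_1 cong: if_cong)
  have fix0: "\<psi> 0 = 0"
    using \<psi>[of "\<lambda>_. 0"] by (simp add: bar_0 tvec_def act_0)
  have "\<psi> (act (t_odd n) v) = act (t_odd n) v" for n
  proof -
    consider "n \<le> \<mu>" | "n = Suc \<mu>" | "n \<ge> \<mu> + 2" by linarith
    then show ?thesis
      by cases (simp_all add: fix_le fix0 act_t_odd_Suc_top act_t_odd_eq_0 del: t_odd.simps)
  qed
  moreover have "\<psi> \<in> V \<rightarrow>\<^sub>E V" by (simp add: \<psi>_def tvec_closed)
  moreover have "\<psi> (x + y) = \<psi> x + \<psi> y" if "x \<in> V" "y \<in> V" for x y
    using that by (elim tvec_surj) (simp add: \<psi> bar_add flip: tvec_add)
  moreover have "\<psi> (act (UScal c) x) = act (UScal (bar c)) (\<psi> x)" if "x \<in> V" for c x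
    using that by (elim tvec_surj) (simp add: \<psi> bar_mult tvec_scale)
  ultimately have "is_bar_involution V act v \<psi>"
    by (simp add: is_bar_involution_def bar_rat_const bar_q)
  then show ?thesis by blast
qed

lemma is_bar_involution_bar_involution:
  "is_bar_involution V act v (bar_involution V act v)"
proof -
  obtain \<psi> where \<psi>: "is_bar_involution V act v \<psi>" using bar_involution_exists ..
  have "\<phi> = \<psi>" if \<phi>: "is_bar_involution V act v \<phi>" for \<phi>
  proof (rule extensionalityI[of _ V])
    show "\<phi> \<in> extensional V" "\<psi> \<in> extensional V"
      using \<phi> \<psi> by (auto simp: is_bar_involution_def PiE_def)
    show "\<phi> x = \<psi> x" if "x \<in> V" for x
      using that by (elim tvec_surj) (simp add: bar_involution_tvec[OF \<phi>] bar_involution_tvec[OF \<psi>])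
  qed
  with \<psi> have "\<exists>!\<phi>. is_bar_involution V act v \<phi>" by blast
  then show ?thesis unfolding bar_involution_def by (rule theI')
qed

lemma is_basis_t_odd: "is_basis \<mu> V act (\<lambda>a\<in>{..\<mu>}. act (t_odd a) v)"
proof -
  have sum: "(\<Sum>a\<le>\<mu>. act (UScal (c a)) ((\<lambda>a\<in>{..\<mu>}. act (t_odd a) v) a)) = tvec \<mu> c" for c
    by (simp add: tvec_eq_sum)
  have "\<exists>!c. c \<in> {..\<mu>} \<rightarrow>\<^sub>E UNIV \<and> x = tvec \<mu> c" if "x \<in> V" for x
  proof -
    obtain d where d: "x = tvec \<mu> d" using \<open>x \<in> V\<close> by (rule tvec_surj)
    show ?thesis
    proof (rule ex1I[of _ "restrict d {..\<mu>}"])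
      show "restrict d {..\<mu>} \<in> {..\<mu>} \<rightarrow>\<^sub>E UNIV \<and> x = tvec \<mu> (restrict d {..\<mu>})"
        unfolding d by (auto intro: tvec_cong)
      fix c assume "c \<in> {..\<mu>} \<rightarrow>\<^sub>E UNIV \<and> x = tvec \<mu> c"
      then show "c = restrict d {..\<mu>}"
        using tvec_inject[of c d] by (intro extensionalityI[of _ "{..\<mu>}"]) (auto simp: d PiE_def)
    qed
  qed
  then show ?thesis unfolding is_basis_def sum by (simp add: act_closed')
qed

lemma is_icanonical_basis_t_odd:
  "is_icanonical_basis \<mu> V act v (\<lambda>a\<in>{..\<mu>}. act (t_odd a) v)"
proof -
  have "\<exists>c. (\<forall>r\<le>\<mu>. c r \<in> qinv_int_polys) \<and>
      act (t_odd a) v = act (Fdiv a) v + (\<Sum>r\<le>\<mu>. act (scaleU (c r) (Fdiv r)) v)"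
    if a: "a \<le> \<mu>" for a
  proof (intro exI conjI allI impI)
    let ?c = "\<lambda>r. if r < a then icoeff l a r else 0"
    show "?c r \<in> qinv_int_polys" for r
      using icoeff_in_qinv_int_polys[of a l r] a by (simp add: weight qinv_int_polys_0)
    have "act (t_odd a) v = act (\<Sum>r\<le>a. scaleU (icoeff l a r) (Fdiv r)) v"
      using a by (simp add: act_t_odd)
    also have "(\<Sum>r\<le>a. scaleU (icoeff l a r) (Fdiv r)) =
        Fdiv a + (\<Sum>r<a. scaleU (icoeff l a r) (Fdiv r))"
      by (simp add: icoeff_diagonal add.commute flip: lessThan_Suc_atMost)
    also have "(\<Sum>r<a. scaleU (icoeff l a r) (Fdiv r)) = (\<Sum>r\<le>\<mu>. scaleU (?c r) (Fdiv r))"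
      using a by (intro sum.mono_neutral_cong_left) auto
    finally show "act (t_odd a) v = act (Fdiv a) v + (\<Sum>r\<le>\<mu>. act (scaleU (?c r) (Fdiv r)) v)"
      by (simp only: act_add_left[OF hwv_closed] act_sum)
  qed
  moreover have "bar_involution V act v (act (t_odd a) v) = act (t_odd a) v" for a
    using is_bar_involution_bar_involution by (simp add: is_bar_involution_def)
  ultimately show ?thesis
    by (simp add: is_icanonical_basis_def is_basis_t_odd act_closed')
qed

lemma icanonical_basis_eq:
  "icanonical_basis \<mu> V act v = (\<lambda>a\<in>{..\<mu>}. act (t_odd a) v)"
  unfolding icanonical_basis_def
proof (rule the_equality)
  show "is_icanonical_basis \<mu> V act v (\<lambda>a\<in>{..\<mu>}. act (t_odd a) v)"
    by (rule is_icanonical_basis_t_odd)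
next
  fix b assume b: "is_icanonical_basis \<mu> V act v b"
  let ?b = "\<lambda>a\<in>{..\<mu>}. act (t_odd a) v"
  show "b = ?b"
  proof (rule extensionalityI[of _ "{..\<mu>}"])
    show "b \<in> extensional {..\<mu>}" using b by (simp add: is_icanonical_basis_def PiE_def)
    fix a assume "a \<in> {..\<mu>}"
    then have a: "a \<le> \<mu>" by simp
    have lattice: "\<exists>c. (\<forall>r\<le>\<mu>. c r \<in> qinv_int_polys) \<and>
        b' a = act (Fdiv a + (\<Sum>r\<le>\<mu>. scaleU (c r) (Fdiv r))) v"
      if "is_icanonical_basis \<mu> V act v b'" for b'
      using that a by (simp add: is_icanonical_basis_def act_add_left[OF hwv_closed] act_sum)
    obtain f where f: "\<And>r. r \<le> \<mu> \<Longrightarrow> f r \<in> qinv_int_polys"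
      "b a = act (Fdiv a + (\<Sum>r\<le>\<mu>. scaleU (f r) (Fdiv r))) v"
      using lattice[OF b] by blast
    obtain g where g: "\<And>r. r \<le> \<mu> \<Longrightarrow> g r \<in> qinv_int_polys"
      "?b a = act (Fdiv a + (\<Sum>r\<le>\<mu>. scaleU (g r) (Fdiv r))) v"
      using lattice[OF is_icanonical_basis_t_odd] by blast
    have "b a \<in> V" using b a by (auto simp: is_icanonical_basis_def)
    then obtain d where d: "b a = tvec \<mu> d" by (rule tvec_surj)
    have "bar_involution V act v (b a) = b a" using b a by (simp add: is_icanonical_basis_def)
    then have bar_d: "bar (d n) = d n" if "n \<le> \<mu>" for n
      using that bar_involution_tvec[OF is_bar_involution_bar_involution] tvec_inject
      unfolding d by metis
    define \<delta> :: "nat \<Rightarrow> ratfun" where "\<delta> i = (if i = a then 1 else 0)" for i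
    have \<delta>: "tvec \<mu> \<delta> = ?b a" using tvec_delta[OF a] a by (simp add: \<delta>_def[abs_def])
    have "tvec \<mu> (\<lambda>n. d n - \<delta> n) = b a - ?b a" by (simp only: tvec_diff d \<delta>)
    also have "\<dots> = act ((Fdiv a + (\<Sum>r\<le>\<mu>. scaleU (f r) (Fdiv r))) -
        (Fdiv a + (\<Sum>r\<le>\<mu>. scaleU (g r) (Fdiv r)))) v"
      by (simp only: f(2) g(2) act_diff)
    also have "(Fdiv a + (\<Sum>r\<le>\<mu>. scaleU (f r) (Fdiv r))) -
        (Fdiv a + (\<Sum>r\<le>\<mu>. scaleU (g r) (Fdiv r))) = (\<Sum>r\<le>\<mu>. scaleU (f r - g r) (Fdiv r))"
      by (simp add: Uq.scale_left_diff_distrib sum_subtractf)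
    finally have "d n - \<delta> n = 0" if "n \<le> \<mu>" for n
      using lattice_bar_invariant_eq_0[of \<mu> "\<lambda>n. d n - \<delta> n" f g n] f(1) g(1) bar_d that
      by (simp add: bar_diff \<delta>_def bar_0 bar_1)
    then have "tvec \<mu> d = tvec \<mu> \<delta>" by (intro tvec_cong) simp
    then show "b a = ?b a" by (simp only: d \<delta>)
  qed simp
qed

text \<open>Independence for arbitrary finite index sets, as needed to compare elements of the algebra with
their actions.\<close>
lemma t_odd_combination_eq_0D:
  assumes "finite F" "F \<subseteq> {..\<mu>}" "act (\<Sum>n\<in>F. scaleU (c n) (t_odd n)) v = 0" "n \<in> F"
  shows "c n = 0"
proof -
  let ?c = "\<lambda>n. if n \<in> F then c n else 0"
  have "(\<Sum>n\<in>F. scaleU (c n) (t_odd n)) = (\<Sum>n\<le>\<mu>. scaleU (?c n) (t_odd n))"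
    using assms(1,2) by (intro sum.mono_neutral_cong_left) auto
  then have "tvec \<mu> ?c = 0" using assms(3) by (simp add: tvec_def)
  moreover have "n \<le> \<mu>" using assms(2,4) by auto
  ultimately have "?c n = 0" using tvec_eq_0D[of \<mu> ?c n] by simp
  then show ?thesis using assms(4) by simp
qed

end

section \<open>The \<open>\<iota>\<close>-canonical basis of the algebra\<close>

lemma t_times_t_odd_in_span: "t * t_odd n \<in> Uq.span (range t_odd)"
proof (induction n rule: t_odd.induct)
  case 1
  have "t_odd (Suc 0) \<in> Uq.span (range t_odd)" by (intro Uq.span_base rangeI)
  then show ?case by simp
next
  case 2
  have "t * t_odd (Suc 0) = scaleU (qint 2) (t_odd 2)"
    using t_odd_even[of 1] by simp
  then show ?case by (simp only: Uq.span_scale Uq.span_base rangeI)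
next
  case (3 n)
  show ?case
  proof (cases "even n")
    case True
    then obtain a where "n = 2 * a" by blast
    then have "t * t_odd (Suc (Suc n)) = scaleU (qint (2 * int (Suc a) + 1)) (t_odd (Suc (Suc (Suc n)))) +
        scaleU (qint (2 * int (Suc a))) (t_odd (Suc n))"
      using t_odd_odd[of "Suc a"] by (simp del: t_odd.simps)
    then show ?thesis by (simp only: Uq.span_add Uq.span_scale Uq.span_base rangeI)
  next
    case False
    then obtain a where "n = 2 * a + 1" by (rule oddE)
    then have "t * t_odd (Suc (Suc n)) = scaleU (qint (2 * int (a + 2))) (t_odd (Suc (Suc (Suc n))))"
      using t_odd_even[of "a + 2"] by (simp del: t_odd.simps)
    then show ?thesis by (simp only: Uq.span_scale Uq.span_base rangeI)
  qed
qed

lemma span_t_odd: "Uq.span (range t_odd) = Uiota"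
proof
  have scale: "scaleU c x \<in> Uiota" if "x \<in> Uiota" for c x
    using that unfolding Uiota_def scaleU_def by (intro subalg_mult subalg_scal)
  have add: "x + y \<in> Uiota" if "x \<in> Uiota" "y \<in> Uiota" for x y
    using that unfolding Uiota_def by (rule subalg_add)
  have diff: "x - y \<in> Uiota" if "x \<in> Uiota" "y \<in> Uiota" for x y
    using add[OF that(1) scale[OF that(2), of "- 1"]] by simp
  have t: "t * x \<in> Uiota" if "x \<in> Uiota" for x
    using that subalg_gen[of t "{t}"] unfolding Uiota_def by (intro subalg_mult) auto
  have one: "1 \<in> Uiota" using subalg_scal[of 1] by (simp add: Uiota_def UScal_1)
  have "t_odd n \<in> Uiota" for n
    by (induction n rule: t_odd.induct) (use t[OF one] in \<open>auto intro!: scale diff t one\<close>)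
  moreover have "Uq.subspace Uiota"
    using scale[OF one, of 0] by (auto simp: Uq.subspace_def intro: scale add)
  ultimately show "Uq.span (range t_odd) \<subseteq> Uiota"
    by (intro Uq.span_minimal) auto
next
  show "Uiota \<subseteq> Uq.span (range t_odd)"
  proof
    fix u assume "u \<in> Uiota"
    then have "\<forall>x\<in>Uq.span (range t_odd). u * x \<in> Uq.span (range t_odd)"
      unfolding Uiota_def
    proof induction
      case (subalg_gen u)
      show ?case
      proof
        fix x assume "x \<in> Uq.span (range t_odd)"
        then show "u * x \<in> Uq.span (range t_odd)"
        proof (induction rule: Uq.span_induct_alt)
          case (step c y x)
          then show ?case using subalg_gen t_times_t_odd_in_span
            by (auto simp: distrib_left scaleU_mult intro!: Uq.span_add Uq.span_scale)
        qed (simp add: Uq.span_zero)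
      qed
    next
      case (subalg_scal c)
      show ?case by (auto intro: Uq.span_scale simp flip: scaleU_def)
    next
      case (subalg_add x y)
      then show ?case by (simp add: distrib_right Uq.span_add)
    next
      case (subalg_mult x y)
      then show ?case by (simp add: mult.assoc)
    qed
    moreover have "t_odd 0 \<in> Uq.span (range t_odd)" by (intro Uq.span_base rangeI)
    ultimately show "u \<in> Uq.span (range t_odd)" by force
  qed
qed

theorem theorem5p5:
  fixes L :: "nat \<Rightarrow> 'v::ab_group_add set"
    and act :: "nat \<Rightarrow> Uq \<Rightarrow> 'v \<Rightarrow> 'v"
    and v :: "nat \<Rightarrow> 'v"
  assumes "\<And>\<mu>. simple_highest_weight_module \<mu> (L \<mu>) (act \<mu>) (v \<mu>)"
  shows "(\<forall>l. let \<mu> = 2 * l + 1 in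
            {act \<mu> (t_odd n) (v \<mu>) | n. n \<le> \<mu>} =
              {icanonical_basis \<mu> (L \<mu>) (act \<mu>) (v \<mu>) a | a. a \<le> \<mu>} \<and>
            act \<mu> (t_odd (2 * l + 2)) (v \<mu>) = act \<mu> (t_odd (2 * l + 1)) (v \<mu>) \<and>
            (\<forall>n \<ge> 2 * l + 3. act \<mu> (t_odd n) (v \<mu>) = 0)) \<and>
         (range t_odd = range (icanonical_odd L act v) \<and>
          Uq.independent (range t_odd) \<and> Uq.span (range t_odd) = Uiota)"
proof -
  have module: "odd_highest_weight_module (2 * l + 1) (L (2 * l + 1)) (act (2 * l + 1)) (v (2 * l + 1)) l"
    for l
    by (intro odd_highest_weight_module.intro odd_highest_weight_module_axioms.intro assms refl)
  have basis: "icanonical_basis (2 * l + 1) (L (2 * l + 1)) (act (2 * l + 1)) (v (2 * l + 1)) a =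
      act (2 * l + 1) (t_odd a) (v (2 * l + 1))" if "a \<le> 2 * l + 1" for l a
    using odd_highest_weight_module.icanonical_basis_eq[OF module[of l]] that by simp
  \<comment> \<open>A combination of finitely many \<open>t_odd n\<close> is detected by any module of sufficiently large odd weight.\<close>
  have kernel: "c n = 0"
    if F: "finite F" "n \<in> F" and ev: "\<forall>\<^sub>F l in sequentially.
      act (2 * l + 1) (\<Sum>n\<in>F. scaleU (c n) (t_odd n)) (v (2 * l + 1)) = 0" for F c n
  proof -
    obtain R where R: "F \<subseteq> {..R}" using F(1) finite_nat_iff_bounded_le by blast
    obtain l where l: "R \<le> l" "act (2 * l + 1) (\<Sum>n\<in>F. scaleU (c n) (t_odd n)) (v (2 * l + 1)) = 0"
      using eventually_happens[OF eventually_conj[OF eventually_ge_at_top[of R] ev]] by auto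
    have "F \<subseteq> {..2 * l + 1}" using R l(1) by auto
    then show ?thesis
      using odd_highest_weight_module.t_odd_combination_eq_0D[OF module F(1) _ l(2) F(2)] by simp
  qed
  have act_0: "act (2 * l + 1) 0 (v (2 * l + 1)) = 0" for l
    by (rule simple_highest_weight_module.act_0[OF assms])
  have indep: "Uq.independent (range t_odd)"
  proof
    assume "Uq.dependent (range t_odd)"
    then obtain S u where S: "finite S" "S \<subseteq> range t_odd" "(\<Sum>x\<in>S. scaleU (u x) x) = 0" "\<exists>x\<in>S. u x \<noteq> 0"
      unfolding Uq.dependent_explicit by blast
    obtain F where F: "inj_on t_odd F" "S = t_odd ` F"
      using S(2) unfolding subset_image_inj by blast
    have "finite F" using F S(1) finite_imageD by blast
    moreover have "(\<Sum>n\<in>F. scaleU (u (t_odd n)) (t_odd n)) = 0"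
      using S(3) F by (simp add: sum.reindex)
    ultimately have "u (t_odd n) = 0" if "n \<in> F" for n
      using kernel[of F n "\<lambda>n. u (t_odd n)"] that act_0 by simp
    then show False using S(4) F(2) by auto
  qed
  have canonical: "icanonical_odd L act v a = t_odd a" for a
    unfolding icanonical_odd_def
  proof (rule the_equality)
    have "\<forall>\<^sub>F l in sequentially. act (2 * l + 1) (t_odd a) (v (2 * l + 1)) =
        icanonical_basis (2 * l + 1) (L (2 * l + 1)) (act (2 * l + 1)) (v (2 * l + 1)) a"
      using eventually_ge_at_top[of a] by eventually_elim (rule basis[symmetric], simp)
    moreover have "t_odd a \<in> Uiota"
      unfolding span_t_odd[symmetric] by (intro Uq.span_base rangeI)
    ultimately show "t_odd a \<in> Uiota \<and> (\<forall>\<^sub>F l in sequentially. act (2 * l + 1) (t_odd a) (v (2 * l + 1)) =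
        icanonical_basis (2 * l + 1) (L (2 * l + 1)) (act (2 * l + 1)) (v (2 * l + 1)) a)"
      by simp
  next
    fix u assume u: "u \<in> Uiota \<and> (\<forall>\<^sub>F l in sequentially. act (2 * l + 1) u (v (2 * l + 1)) =
        icanonical_basis (2 * l + 1) (L (2 * l + 1)) (act (2 * l + 1)) (v (2 * l + 1)) a)"
    then have "u - t_odd a \<in> Uq.span (range t_odd)"
      unfolding span_t_odd[symmetric] by (intro Uq.span_diff Uq.span_base[of "t_odd a"] rangeI) simp
    then obtain F c where F: "finite F" "u - t_odd a = (\<Sum>n\<in>F. scaleU (c n) (t_odd n))"
      by (rule Uq_span_imageD)
    have "\<forall>\<^sub>F l in sequentially. act (2 * l + 1) (u - t_odd a) (v (2 * l + 1)) = 0"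
      using u[THEN conjunct2] eventually_ge_at_top[of a]
    proof eventually_elim
      case (elim l)
      then show ?case
        using basis[of a l] simple_highest_weight_module.act_diff[OF assms] by simp
    qed
    then have "c n = 0" if "n \<in> F" for n
      unfolding F(2) using kernel F(1) that by blast
    then show "u = t_odd a" using F(2) by simp
  qed
  have sets: "{act (2 * l + 1) (t_odd n) (v (2 * l + 1)) | n. n \<le> 2 * l + 1} =
      {icanonical_basis (2 * l + 1) (L (2 * l + 1)) (act (2 * l + 1)) (v (2 * l + 1)) a | a. a \<le> 2 * l + 1}"
    for l
    using basis[of _ l] by (metis (no_types, lifting))
  have top: "act (2 * l + 1) (t_odd (2 * l + 2)) (v (2 * l + 1)) =
      act (2 * l + 1) (t_odd (2 * l + 1)) (v (2 * l + 1))" for l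
    using odd_highest_weight_module.act_t_odd_Suc_top[OF module[of l]] by (simp del: t_odd.simps)
  have vanish: "act (2 * l + 1) (t_odd n) (v (2 * l + 1)) = 0" if "n \<ge> 2 * l + 3" for l n
    using odd_highest_weight_module.act_t_odd_eq_0[OF module[of l]] that by simp
  have "icanonical_odd L act v = t_odd" using canonical by (rule ext)
  then show ?thesis
    unfolding Let_def by (simp only:) (intro conjI allI impI refl sets top vanish indep span_t_odd)
qed

end
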